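(* Let $q$ be a prime power, let $n\ge 1$, and let $0\le r,r'\le n(q-1)$ be integers such that $r+r'=n(q-1)$. Let $\theta:H_q(r,n)\to H_q(r',n)$ be the $\mathbb F_q$-linear map determined by $\theta(X^{\boldsymbol i})=\boldsymbol i!\,(-1)^nX^{\bar{\boldsymbol i}}$ for all $\boldsymbol i\in\Omega_{q,n,r}$. Then for each $A\in\mathrm{GL}(n,\mathbb F_q)$ we have $$\theta\circ A=(A^{-1})^T\circ\theta$$ as maps $H_q(r,n)\to H_q(r',n)$, where $A$ denotes the action of $A$ on $H_q(r,n)$ and $(A^{-1})^T$ denotes the action of the matrix $(A^{-1})^T$ on $H_q(r',n)$. In particular, when $q$ is a prime or $r<\mathrm{char}\,\mathbb F_q$, elements $f,g\in H_q(r,n)$ are GL-equivalent if and only if $\theta(f),\theta(g)\in H_q(r',n)$ are GL-equivalent.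
   Context: $\mathcal F(\mathbb F_q^n,\mathbb F_q)$ is the $\mathbb F_q$-algebra of all functions $\mathbb F_q^n\to\mathbb F_q$. Each such function is uniquely represented by a reduced polynomial, i.e. an $f\in\mathbb F_q[X_1,\dots,X_n]$ with $\deg_{X_i}f\le q-1$ for all $i$; the degree of the function is the degree of its reduced polynomial. For $0\le r\le n(q-1)$, $R_q(r,n)=\{f\in\mathcal F(\mathbb F_q^n,\mathbb F_q):\deg f\le r\}$, $R_q(-1,n)=\{0\}$, and $H_q(r,n)=R_q(r,n)/R_q(r-1,n)$. $\Omega_{q,n}=\{0,1,\dots,q-1\}^n$. For $\boldsymbol i=(i_1,\dots,i_n)\in\Omega_{q,n}$: $|\boldsymbol i|=i_1+\cdots+i_n$, $\bar{\boldsymbol i}=(q-1-i_1,\dots,q-1-i_n)$, $X^{\boldsymbol i}=X_1^{i_1}\cdots X_n^{i_n}$, and $\boldsymbol i!=i_1!\cdots i_n!$ (viewed in $\mathbb F_q$ when used as a scalar). $\Omega_{q,n,r}=\{\boldsymbol i\in\Omega_{q,n}:|\boldsymbol i|=r\}$. The classes of $X^{\boldsymbol i}$, $\boldsymbol i\in\Omega_{q,n,r}$ (again denoted $X^{\boldsymbol i}$), form an $\mathbb F_q$-basis of $H_q(r,n)$. The group $\mathrm{GL}(n,\mathbb F_q)$ acts on $\mathcal F(\mathbb F_q^n,\mathbb F_q)$ by $A(f)=f((X_1,\dots,X_n)A)$; this preserves each $R_q(r,n)$ and hence induces an action on each $H_q(r,n)$. Two elements of $H_q(r,n)$ are GL-equivalent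 if they lie in the same $\mathrm{GL}(n,\mathbb F_q)$-orbit. *)

theory Defs
  imports
    "HOL-Analysis.Cartesian_Space"
    "HOL-Library.Poly_Mapping"
    "HOL-Library.FuncSet"
    "HOL-Computational_Algebra.Computational_Algebra"
begin

text \<open>
  The field with \<open>q\<close> elements is a type \<open>'a :: {field, finite}\<close> with \<open>q = CARD('a)\<close>, and the
  coordinates are indexed by a finite type \<open>'n\<close> with \<open>n = CARD('n) \<ge> 1\<close>.  Functions from the
  \<open>n\<close>-dimensional space to the field have type \<open>'a^'n \<Rightarrow> 'a\<close>; polynomials in the variables
  indexed by \<open>'n\<close> have type \<open>('n \<Rightarrow>\<^sub>0 nat) \<Rightarrow>\<^sub>0 'a\<close>.
\<close>

type_synonym ('a, 'n) mv_poly = "('n \<Rightarrow>\<^sub>0 nat) \<Rightarrow>\<^sub>0 'a"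

subsection \<open>Multi-indices\<close>

definition exps :: "nat \<Rightarrow> ('n::finite \<Rightarrow>\<^sub>0 nat) set" where
  "exps q = {i. \<forall>k. Poly_Mapping.lookup i k \<le> q - 1}"

definition total :: "('n::finite \<Rightarrow>\<^sub>0 nat) \<Rightarrow> nat" where
  "total i = (\<Sum>k\<in>UNIV. Poly_Mapping.lookup i k)"

definition exps_of_total :: "nat \<Rightarrow> nat \<Rightarrow> ('n::finite \<Rightarrow>\<^sub>0 nat) set" where
  "exps_of_total q r = {i \<in> exps q. total i = r}"

text \<open>The multi-index with entries \<open>q - 1 - i\<^sub>k\<close>; the subtraction does not truncate on \<open>exps q\<close>.\<close>

definition exp_compl :: "nat \<Rightarrow> ('n::finite \<Rightarrow>\<^sub>0 nat) \<Rightarrow> ('n \<Rightarrow>\<^sub>0 nat)" where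
  "exp_compl q i = Abs_poly_mapping (\<lambda>k. q - 1 - Poly_Mapping.lookup i k)"

lemma lookup_exp_compl [simp]: "Poly_Mapping.lookup (exp_compl q i) k = q - 1 - Poly_Mapping.lookup i k"
  by (simp add: exp_compl_def)

definition exp_fact :: "('n::finite \<Rightarrow>\<^sub>0 nat) \<Rightarrow> nat" where
  "exp_fact i = (\<Prod>k\<in>UNIV. fact (Poly_Mapping.lookup i k))"

definition monom_fun :: "('n::finite \<Rightarrow>\<^sub>0 nat) \<Rightarrow> ('a::{field,finite}^'n \<Rightarrow> 'a)" where
  "monom_fun i = (\<lambda>x. \<Prod>k\<in>UNIV. (x $ k) ^ Poly_Mapping.lookup i k)"

subsection \<open>Reduced polynomials and the degree of a function\<close>

definition poly_fun :: "('a, 'n) mv_poly \<Rightarrow> ('a::{field,finite}^'n::finite \<Rightarrow> 'a)" where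
  "poly_fun p = (\<lambda>x. \<Sum>i\<in>Poly_Mapping.keys p. Poly_Mapping.lookup p i * monom_fun i x)"

definition reduced :: "('a::{field,finite}, 'n::finite) mv_poly \<Rightarrow> bool" where
  "reduced p \<longleftrightarrow> Poly_Mapping.keys p \<subseteq> exps CARD('a)"

definition reduced_poly :: "('a::{field,finite}^'n::finite \<Rightarrow> 'a) \<Rightarrow> ('a, 'n) mv_poly" where
  "reduced_poly f = (THE p. reduced p \<and> poly_fun p = f)"

text \<open>The zero polynomial gets total degree \<open>0\<close>, as for the univariate \<^const>\<open>degree\<close>.\<close>

definition total_degree :: "('a::{field,finite}, 'n::finite) mv_poly \<Rightarrow> nat" where
  "total_degree p = Max (insert 0 (total ` Poly_Mapping.keys p))"

definition fun_degree :: "('a::{field,finite}^'n::finite \<Rightarrow> 'a) \<Rightarrow> nat" where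
  "fun_degree f = total_degree (reduced_poly f)"

subsection \<open>The spaces \<open>R\<^sub>q(r,n)\<close> and their quotients \<open>H\<^sub>q(r,n)\<close>\<close>

text \<open>The only negative index that is used is \<open>r = -1\<close>.\<close>

definition RM :: "int \<Rightarrow> ('a::{field,finite}^'n::finite \<Rightarrow> 'a) set" where
  "RM r = (if r < 0 then {\<lambda>x. 0} else {f. int (fun_degree f) \<le> r})"

definition RM_rel :: "nat \<Rightarrow> (('a::{field,finite}^'n::finite \<Rightarrow> 'a) \<times> ('a^'n \<Rightarrow> 'a)) set" where
  "RM_rel r = {(f, g). f \<in> RM (int r) \<and> g \<in> RM (int r) \<and> (\<lambda>x. f x - g x) \<in> RM (int r - 1)}"

definition H :: "nat \<Rightarrow> ('a::{field,finite}^'n::finite \<Rightarrow> 'a) set set" where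
  "H r = RM (int r) // RM_rel r"

definition H_class :: "nat \<Rightarrow> ('a::{field,finite}^'n::finite \<Rightarrow> 'a) \<Rightarrow> ('a^'n \<Rightarrow> 'a) set" where
  "H_class r f = RM_rel r `` {f}"

text \<open>
  The operations on \<open>H r\<close> are those of \<open>RM (int r)\<close> applied to representatives; on elements of
  \<open>H r\<close> all sets in the unions below coincide.
\<close>

definition H_add ::
  "nat \<Rightarrow> ('a::{field,finite}^'n::finite \<Rightarrow> 'a) set \<Rightarrow> ('a^'n \<Rightarrow> 'a) set \<Rightarrow> ('a^'n \<Rightarrow> 'a) set" where
  "H_add r U V = (\<Union>f\<in>U. \<Union>g\<in>V. H_class r (\<lambda>x. f x + g x))"

definition H_scale ::
  "nat \<Rightarrow> 'a \<Rightarrow> ('a::{field,finite}^'n::finite \<Rightarrow> 'a) set \<Rightarrow> ('a^'n \<Rightarrow> 'a) set" where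
  "H_scale r c U = (\<Union>f\<in>U. H_class r (\<lambda>x. c * f x))"

subsection \<open>The action of the general linear group\<close>

definition GL :: "('a::{field,finite}^'n::finite^'n) set" where
  "GL = {A. invertible A}"

text \<open>The variables form a row vector, which is multiplied by \<open>A\<close> from the right.\<close>

definition act :: "'a^'n^'n \<Rightarrow> ('a::{field,finite}^'n::finite \<Rightarrow> 'a) \<Rightarrow> ('a^'n \<Rightarrow> 'a)" where
  "act A f = (\<lambda>x. f (x v* A))"

definition H_act ::
  "nat \<Rightarrow> 'a^'n^'n \<Rightarrow> ('a::{field,finite}^'n::finite \<Rightarrow> 'a) set \<Rightarrow> ('a^'n \<Rightarrow> 'a) set" where
  "H_act r A U = (\<Union>f\<in>U. H_class r (act A f))"

definition GL_equiv ::
  "nat \<Rightarrow> ('a::{field,finite}^'n::finite \<Rightarrow> 'a) set \<Rightarrow> ('a^'n \<Rightarrow> 'a) set \<Rightarrow> bool" where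
  "GL_equiv r U V \<longleftrightarrow> (\<exists>A\<in>GL. H_act r A U = V)"

subsection \<open>The map \<open>\<theta>\<close>\<close>

definition H_linear ::
  "nat \<Rightarrow> nat \<Rightarrow> (('a::{field,finite}^'n::finite \<Rightarrow> 'a) set \<Rightarrow> ('a^'n \<Rightarrow> 'a) set) \<Rightarrow> bool" where
  "H_linear r r' T \<longleftrightarrow>
     T \<in> H r \<rightarrow> H r' \<and>
     (\<forall>U\<in>H r. \<forall>V\<in>H r. T (H_add r U V) = H_add r' (T U) (T V)) \<and>
     (\<forall>c. \<forall>U\<in>H r. T (H_scale r c U) = H_scale r' c (T U))"

text \<open>
  The linear map determined by its values on the basis of monomial classes; \<^const>\<open>extensional\<close>
  fixes the irrelevant values outside \<open>H r\<close>.  It is only meaningful if \<open>r + r' = n(q - 1)\<close>.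
\<close>

definition theta ::
  "nat \<Rightarrow> nat \<Rightarrow> ('a::{field,finite}^'n::finite \<Rightarrow> 'a) set \<Rightarrow> ('a^'n \<Rightarrow> 'a) set" where
  "theta r r' = (THE T. T \<in> extensional (H r) \<and> H_linear r r' T \<and>
     (\<forall>i\<in>exps_of_total CARD('a) r.
        T (H_class r (monom_fun i)) =
          H_scale r' (of_nat (exp_fact i) * (-1) ^ CARD('n))
            (H_class r' (monom_fun (exp_compl CARD('a) i)))))"

end

theory Submission
  imports Defs
begin

text \<open>
  The pairing \<open>\<langle>f, g\<rangle> = \<Sum>x. f x * g x\<close> is invariant under the general linear group, and modulo
  functions of lower degree \<open>(-1)\<^sup>n X\<^sup>j\<close> with \<open>j = exp_compl q i\<close> is dual to \<open>X\<^sup>i\<close>.  Hence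
  \<open>\<theta>\<close> is characterised by \<open>\<langle>\<theta> f, X\<^sup>i\<rangle> = i! f\<^sub>i\<close>, where \<open>f\<^sub>i\<close> is the coefficient of \<open>X\<^sup>i\<close> in \<open>f\<close>,
  that is, by \<open>\<langle>\<theta> f, g\<rangle> = (f, g)\<close> for the apolar form with
  \<open>(X\<^sup>i, X\<^sup>j) = i!\<close> if \<open>i = j\<close> and \<open>0\<close> otherwise.  The apolar form satisfies
  \<open>(A f, g) = (f, A\<^sup>T g)\<close>, because \<open>(A X\<^sup>i, X\<^sup>j)\<close> is a permanent in the entries of \<open>A\<close>.  Therefore
  \<open>\<langle>\<theta> (A f), g\<rangle> = (f, A\<^sup>T g) = \<langle>\<theta> f, A\<^sup>T g\<rangle> = \<langle>A\<^sup>-\<^sup>T (\<theta> f), g\<rangle>\<close>, and the pairing is perfect.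
\<close>

subsection \<open>Power sums over a finite field\<close>

text \<open>Translation by \<open>1\<close> permutes the field, so adding up the translates changes
  nothing, although it adds \<open>1\<close> once for every element.\<close>

lemma of_nat_CARD_eq_0: "of_nat CARD('a) = (0 :: 'a::{field,finite})"
proof -
  have "(\<Sum>x\<in>UNIV. x + 1 :: 'a) = \<Sum>UNIV"
    by (rule sum.reindex_bij_witness[of _ "\<lambda>x. x - 1" "\<lambda>x. x + 1"]) auto
  then show ?thesis
    by (simp add: sum.distrib)
qed

lemma CARD_field_gt_1: "1 < CARD('a::{field,finite})"
proof -
  have "card {0, 1 :: 'a} \<le> CARD('a)"
    by (intro card_mono) auto
  then show ?thesis by simp
qed

text \<open>Multiplication by \<open>x\<close> permutes the nonzero elements; comparing their
  products and cancelling gives the claim.\<close>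

lemma field_power_CARD_minus_1:
  fixes x :: "'a::{field,finite}"
  assumes "x \<noteq> 0"
  shows "x ^ (CARD('a) - 1) = 1"
proof -
  have "(\<Prod>y\<in>UNIV - {0}. x * y) = (\<Prod>y\<in>UNIV - {0}. y)"
    by (rule prod.reindex_bij_witness[of _ "\<lambda>y. y / x" "\<lambda>y. x * y"]) (use assms in auto)
  then show ?thesis
    by (simp add: prod.distrib card_Diff_singleton)
qed

text \<open>For \<open>k > 0\<close> the polynomial \<open>X^k - 1\<close> has too few roots to
  vanish at every nonzero element. Scaling the summation variable by a nonzero non-root
  \<open>y\<close> multiplies the sum by \<open>y ^ k\<close>, which is not
  \<open>1\<close>.\<close>

lemma sum_field_power_eq_0:
  assumes "k < CARD('a::{field,finite}) - 1"
  shows "(\<Sum>x\<in>UNIV. x ^ k :: 'a) = 0"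
proof (cases "k = 0")
  case True
  \<comment> \<open>Since \<open>0 ^ 0 = 1\<close>, the sum counts all field elements.\<close>
  then show ?thesis
    by (simp add: of_nat_CARD_eq_0)
next
  case False
  have "\<exists>y::'a. y \<noteq> 0 \<and> y ^ k \<noteq> 1"
  proof (rule ccontr)
    assume "\<not> ?thesis"
    then have sub: "UNIV - {0 :: 'a} \<subseteq> {x. poly (monom 1 k - 1) x = 0}"
      by (auto simp: poly_monom)
    have nz: "monom 1 k - 1 \<noteq> (0 :: 'a poly)"
    proof
      assume "monom 1 k - 1 = (0 :: 'a poly)"
      then have "coeff (monom 1 k - 1 :: 'a poly) k = 0" by simp
      with False show False by simp
    qed
    have "CARD('a) - 1 = card (UNIV - {0 :: 'a})"
      by (simp add: card_Diff_singleton)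
    also have "\<dots> \<le> card {x. poly (monom 1 k - 1 :: 'a poly) x = 0}"
      by (intro card_mono sub) simp
    also have "\<dots> \<le> degree (monom 1 k - 1 :: 'a poly)"
      by (rule card_poly_roots_bound[OF nz])
    also have "\<dots> \<le> k"
      by (rule degree_diff_le) (auto simp: degree_monom_le)
    finally show False using assms by simp
  qed
  then obtain y :: 'a where y: "y \<noteq> 0" "y ^ k \<noteq> 1" by blast
  have "(\<Sum>x\<in>UNIV. x ^ k :: 'a) = (\<Sum>x\<in>UNIV. (y * x) ^ k)"
    by (rule sum.reindex_bij_witness[of _ "\<lambda>x. y * x" "\<lambda>x. x / y"]) (use y in auto)
  also have "\<dots> = y ^ k * (\<Sum>x\<in>UNIV. x ^ k)"
    by (simp add: power_mult_distrib sum_distrib_left)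
  finally show ?thesis using y by simp
qed

lemma sum_field_power_CARD_minus_1:
  "(\<Sum>x\<in>UNIV. x ^ (CARD('a) - 1)) = (-1 :: 'a::{field,finite})"
proof -
  \<comment> \<open>The term at \<open>0\<close> vanishes because the exponent is positive.\<close>
  have "(\<Sum>x\<in>UNIV. x ^ (CARD('a) - 1) :: 'a) = (\<Sum>x\<in>UNIV - {0}. x ^ (CARD('a) - 1))"
    by (rule sum.mono_neutral_right) (use CARD_field_gt_1[where 'a='a] in \<open>auto simp: power_0_left\<close>)
  also have "\<dots> = (\<Sum>x\<in>UNIV - {0 :: 'a}. 1)"
    by (intro sum.cong refl field_power_CARD_minus_1) simp
  also have "\<dots> = of_nat CARD('a) - 1"
    using CARD_field_gt_1[where 'a='a] by (simp add: card_Diff_singleton)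
  finally show ?thesis by (simp add: of_nat_CARD_eq_0)
qed

text \<open>Distributivity, with vectors as choice functions. It reduces sums over the whole space
  to one-variable power sums.\<close>

lemma sum_vec_prod:
  fixes f :: "'n::finite \<Rightarrow> 'b::finite \<Rightarrow> 'c::comm_semiring_1"
  shows "(\<Sum>x\<in>UNIV. \<Prod>k\<in>UNIV. f k (x $ k)) = (\<Prod>k\<in>UNIV. \<Sum>a\<in>UNIV. f k a)"
proof -
  have "(\<Prod>k\<in>UNIV. \<Sum>a\<in>UNIV. f k a) = (\<Sum>g\<in>UNIV. \<Prod>k\<in>UNIV. f k (g k))"
    by (subst prod_sum_PiE) auto
  also have "\<dots> = (\<Sum>x\<in>UNIV. \<Prod>k\<in>UNIV. f k (x $ k))"
    by (rule sum.reindex_bij_witness[of _ vec_nth vec_lambda]) auto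
  finally show ?thesis ..
qed

subsection \<open>The trace pairing\<close>

definition pairing :: "('b::finite \<Rightarrow> 'a::comm_semiring_1) \<Rightarrow> ('b \<Rightarrow> 'a) \<Rightarrow> 'a" where
  "pairing f g = (\<Sum>x\<in>UNIV. f x * g x)"

lemma pairing_commute: "pairing f g = pairing g f"
  by (simp add: pairing_def mult.commute)

lemma pairing_add_left: "pairing (\<lambda>x. f x + g x) h = pairing f h + pairing g h"
  by (simp add: pairing_def distrib_right sum.distrib)

lemma pairing_diff_left:
  fixes h :: "'b::finite \<Rightarrow> 'a::comm_ring_1"
  shows "pairing (\<lambda>x. f x - g x) h = pairing f h - pairing g h"
  by (simp add: pairing_def left_diff_distrib sum_subtractf)

lemma pairing_scale_left: "pairing (\<lambda>x. c * f x) h = c * pairing f h"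
  by (simp add: pairing_def sum_distrib_left mult.assoc)

lemma pairing_sum_left:
  "pairing (\<lambda>x. \<Sum>i\<in>I. c i * f i x) h = (\<Sum>i\<in>I. c i * pairing (f i) h)"
  by (simp add: pairing_def sum_distrib_left sum_distrib_right mult.assoc sum.swap[of _ UNIV])

abbreviation dual_monom :: "('n \<Rightarrow>\<^sub>0 nat) \<Rightarrow> ('a::{field,finite}^'n::finite \<Rightarrow> 'a)" where
  "dual_monom j \<equiv> monom_fun (exp_compl CARD('a) j)"

text \<open>A strict inequality in one coordinate would make the totals strictly ordered.
  Contrapositively, distinct exponents with \<open>total i \<le> total j\<close> have a coordinate
  where \<open>i\<close> is smaller than \<open>j\<close>.\<close>

lemma total_eq_imp_eq:
  assumes le: "\<And>k. Poly_Mapping.lookup j k \<le> Poly_Mapping.lookup i k" and tot: "total i \<le> total j"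
  shows "i = j"
proof (rule poly_mapping_eqI)
  fix k
  show "Poly_Mapping.lookup i k = Poly_Mapping.lookup j k"
  proof (rule ccontr)
    assume "\<not> ?thesis"
    with le[of k] have "Poly_Mapping.lookup j k < Poly_Mapping.lookup i k" by simp
    then have "total j < total i"
      unfolding total_def by (intro sum_strict_mono_ex1) (use le in auto)
    with tot show False by simp
  qed
qed

text \<open>
  The exponent \<open>i\<close> need not be reduced: this is what makes explicit reductions modulo
  \<open>X\<^sup>q - X\<close> unnecessary throughout.
\<close>

lemma pairing_monom:
  fixes i j :: "'n::finite \<Rightarrow>\<^sub>0 nat"
  assumes j: "j \<in> exps CARD('a)" and tot: "total i \<le> total j"
  shows "pairing (monom_fun i) (dual_monom j :: 'a::{field,finite}^'n \<Rightarrow> 'a) =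
    (if i = j then (-1) ^ CARD('n) else 0)"
proof -
  let ?e = "\<lambda>k. Poly_Mapping.lookup i k + (CARD('a) - 1 - Poly_Mapping.lookup j k)"
  have jle: "Poly_Mapping.lookup j k \<le> CARD('a) - 1" for k
    using j by (auto simp: exps_def)
  have eq: "pairing (monom_fun i) (dual_monom j :: 'a^'n \<Rightarrow> 'a) =
      (\<Prod>k\<in>UNIV. \<Sum>a\<in>UNIV. (a::'a) ^ ?e k)"
    unfolding sum_vec_prod[symmetric] by (simp add: pairing_def monom_fun_def power_add prod.distrib)
  show ?thesis
  proof (cases "i = j")
    case True
    then have "?e k = CARD('a) - 1" for k using jle[of k] by simp
    then show ?thesis
      unfolding eq using True by (simp del: One_nat_def add: sum_field_power_CARD_minus_1)
  next
    case False
    \<comment> \<open>In a coordinate where \<open>i\<close> is below \<open>j\<close> the exponent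
      falls below \<open>q - 1\<close>, so one factor of the product is zero.\<close>
    have "\<not> (\<forall>k. Poly_Mapping.lookup j k \<le> Poly_Mapping.lookup i k)"
      using total_eq_imp_eq[of j i] tot False by auto
    then obtain k where "Poly_Mapping.lookup i k < Poly_Mapping.lookup j k"
      by (auto simp: not_le)
    then have "?e k < CARD('a) - 1" using jle[of k] by simp
    then have "(\<Sum>a\<in>UNIV. (a::'a) ^ ?e k) = 0" by (rule sum_field_power_eq_0)
    then have "(\<Prod>k\<in>UNIV. \<Sum>a\<in>UNIV. (a::'a) ^ ?e k) = 0"
      by (intro prod_zero) auto
    then show ?thesis using False eq by simp
  qed
qed

subsection \<open>Reduced polynomials\<close>

lemma lookup_image_exps:
  "Poly_Mapping.lookup ` exps q = (UNIV \<rightarrow>\<^sub>E {..q - 1} :: ('n::finite \<Rightarrow> nat) set)"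
proof (intro equalityI subsetI)
  fix g :: "'n \<Rightarrow> nat" assume g: "g \<in> UNIV \<rightarrow>\<^sub>E {..q - 1}"
  have "g = Poly_Mapping.lookup (Abs_poly_mapping g)" by simp
  moreover have "Abs_poly_mapping g \<in> exps q"
    using g by (auto simp: exps_def)
  ultimately show "g \<in> Poly_Mapping.lookup ` exps q" by (rule image_eqI)
qed (auto simp: exps_def)

lemma inj_on_lookup: "inj_on Poly_Mapping.lookup A"
  by (simp add: inj_on_def poly_mapping.lookup_inject)

lemma finite_exps [simp]: "finite (exps q :: ('n::finite \<Rightarrow>\<^sub>0 nat) set)"
  by (rule finite_imageD[OF _ inj_on_lookup]) (simp add: lookup_image_exps finite_PiE)

lemma card_exps: "q > 0 \<Longrightarrow> card (exps q :: ('n::finite \<Rightarrow>\<^sub>0 nat) set) = q ^ CARD('n)"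
  using card_image[OF inj_on_lookup, of "exps q :: ('n \<Rightarrow>\<^sub>0 nat) set"]
  by (simp add: lookup_image_exps card_funcsetE)

text \<open>Reduced polynomials with an arbitrary function as coefficient family, of which only the
  values on \<open>exps\<close> matter. Coefficients can thus be manipulated pointwise, without
  finite-support obligations.\<close>

definition lin_comb :: "(('n \<Rightarrow>\<^sub>0 nat) \<Rightarrow> 'a) \<Rightarrow> ('a::{field,finite}^'n::finite \<Rightarrow> 'a)" where
  "lin_comb c = (\<lambda>x. \<Sum>i\<in>exps CARD('a). c i * monom_fun i x)"

text \<open>Every exponent of the support satisfies the degree condition of
  \<open>pairing_monom\<close>, so only \<open>i = j\<close> contributes. Pairing with a dual
  monomial thus reads off a coefficient of top degree.\<close>

lemma pairing_lin_comb:
  fixes c :: "('n::finite \<Rightarrow>\<^sub>0 nat) \<Rightarrow> 'a::{field,finite}"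
  assumes j: "j \<in> exps CARD('a)"
    and top: "\<And>i. i \<in> exps CARD('a) \<Longrightarrow> c i \<noteq> 0 \<Longrightarrow> total i \<le> total j"
  shows "pairing (lin_comb c) (dual_monom j) = c j * (-1) ^ CARD('n)"
proof -
  have "pairing (lin_comb c) (dual_monom j) =
      (\<Sum>i\<in>exps CARD('a). if i = j then c j * (-1) ^ CARD('n) else 0)"
    unfolding lin_comb_def pairing_sum_left
  proof (intro sum.cong refl)
    fix i :: "'n \<Rightarrow>\<^sub>0 nat" assume i: "i \<in> exps CARD('a)"
    show "c i * pairing (monom_fun i) (dual_monom j) = (if i = j then c j * (-1) ^ CARD('n) else 0)"
      using top[OF i] pairing_monom[OF j, of i] by (cases "c i = 0") auto
  qed
  with j show ?thesis by simp
qed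

lemma ex_top_coeff:
  fixes c :: "('n::finite \<Rightarrow>\<^sub>0 nat) \<Rightarrow> 'a::zero"
  assumes "i \<in> exps q" "c i \<noteq> 0"
  obtains j where "j \<in> exps q" "c j \<noteq> 0" "\<And>i. i \<in> exps q \<Longrightarrow> c i \<noteq> 0 \<Longrightarrow> total i \<le> total j"
proof -
  let ?S = "{i \<in> exps q. c i \<noteq> 0}"
  have "Max (total ` ?S) \<in> total ` ?S" using assms by (intro Max_in) auto
  then obtain j where "j \<in> ?S" "total j = Max (total ` ?S)" by auto
  moreover have "total i \<le> Max (total ` ?S)" if "i \<in> ?S" for i
    using that by (intro Max_ge) auto
  ultimately show ?thesis using that by auto
qed

text \<open>Reduced monomials are linearly independent: a term of top degree in the difference would
  be detected by its dual monomial, but the difference is the zero function.\<close>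

lemma lin_comb_eqD:
  fixes c d :: "('n::finite \<Rightarrow>\<^sub>0 nat) \<Rightarrow> 'a::{field,finite}"
  assumes eq: "lin_comb c = lin_comb d" and i: "i \<in> exps CARD('a)"
  shows "c i = d i"
proof (rule ccontr)
  assume "c i \<noteq> d i"
  then have "c i - d i \<noteq> 0" by simp
  then obtain j where j: "j \<in> exps CARD('a)" "c j - d j \<noteq> 0"
    "\<And>i. i \<in> exps CARD('a) \<Longrightarrow> c i - d i \<noteq> 0 \<Longrightarrow> total i \<le> total j"
    using ex_top_coeff[of i "CARD('a)" "\<lambda>i. c i - d i"] i by metis
  have "lin_comb (\<lambda>i. c i - d i) = (\<lambda>x. lin_comb c x - lin_comb d x)"
    by (simp add: lin_comb_def left_diff_distrib sum_subtractf)
  then have "pairing (lin_comb (\<lambda>i. c i - d i)) (dual_monom j) = 0"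
    by (simp add: eq pairing_def)
  with pairing_lin_comb[OF j(1), of "\<lambda>i. c i - d i"] j show False by auto
qed

text \<open>A counting argument: on coefficient families supported by \<open>exps\<close>,
  \<open>lin_comb\<close> is injective, and there are \<open>q^(q^n)\<close> of them, as many as
  functions.\<close>

lemma lin_comb_surj:
  fixes f :: "'a::{field,finite}^'n::finite \<Rightarrow> 'a"
  obtains c where "f = lin_comb c"
proof -
  let ?C = "exps CARD('a) \<rightarrow>\<^sub>E UNIV :: (('n \<Rightarrow>\<^sub>0 nat) \<Rightarrow> 'a) set"
  have "card (lin_comb ` ?C) = card ?C"
    by (intro card_image inj_onI PiE_ext[of _ "exps CARD('a)" "\<lambda>_. UNIV"]) (auto dest: lin_comb_eqD)
  also have "\<dots> = CARD('a^'n \<Rightarrow> 'a)"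
  proof -
    have "CARD('a^'n \<Rightarrow> 'a) = card (UNIV \<rightarrow>\<^sub>E UNIV :: ('a^'n \<Rightarrow> 'a) set)" by simp
    then show ?thesis
      by (simp add: card_funcsetE card_exps del: PiE_UNIV)
  qed
  finally have "lin_comb ` ?C = (UNIV :: ('a^'n \<Rightarrow> 'a) set)"
    by (intro card_subset_eq) auto
  then have "f \<in> lin_comb ` ?C" by simp
  with that show ?thesis by blast
qed

lemma poly_fun_reduced: "reduced p \<Longrightarrow> poly_fun p = lin_comb (Poly_Mapping.lookup p)"
  unfolding poly_fun_def lin_comb_def reduced_def
  by (intro ext sum.mono_neutral_left) (auto simp: in_keys_iff)

text \<open>This resolves the description operator in \<open>reduced_poly\<close>, by linear
  independence, and makes the degree of a function visible in its coefficients.\<close>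

lemma keys_reduced_poly_lin_comb:
  fixes c :: "('n::finite \<Rightarrow>\<^sub>0 nat) \<Rightarrow> 'a::{field,finite}"
  shows "Poly_Mapping.keys (reduced_poly (lin_comb c)) = {i \<in> exps CARD('a). c i \<noteq> 0}"
proof -
  \<comment> \<open>The family \<open>c\<close> is unconstrained outside \<open>exps\<close>;
    cutting it off there gives finite support and a reduced polynomial.\<close>
  let ?g = "\<lambda>i. if i \<in> exps CARD('a) then c i else 0"
  define p where "p = Abs_poly_mapping ?g"
  have fin: "finite {i. ?g i \<noteq> 0}"
    by (rule finite_subset[of _ "exps CARD('a)"]) (auto split: if_splits)
  have lookup: "Poly_Mapping.lookup p = ?g"
    unfolding p_def by (rule lookup_Abs_poly_mapping[OF fin])
  have keys: "Poly_Mapping.keys p = {i \<in> exps CARD('a). c i \<noteq> 0}"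
    by (auto simp: in_keys_iff lookup split: if_splits)
  have red: "reduced p" by (auto simp: reduced_def keys)
  have pf: "poly_fun p = lin_comb c"
    unfolding poly_fun_reduced[OF red] by (simp add: lin_comb_def lookup)
  have "reduced_poly (lin_comb c) = p"
    unfolding reduced_poly_def
  proof (rule the_equality)
    fix p' assume p': "reduced p' \<and> poly_fun p' = lin_comb c"
    then have eq: "lin_comb (Poly_Mapping.lookup p') = lin_comb (Poly_Mapping.lookup p)"
      using pf poly_fun_reduced[OF red] poly_fun_reduced[of p'] by simp
    show "p' = p"
    proof (rule poly_mapping_eqI)
      fix i
      show "Poly_Mapping.lookup p' i = Poly_Mapping.lookup p i"
      proof (cases "i \<in> exps CARD('a)")
        case True then show ?thesis using lin_comb_eqD[OF eq] by blast
      next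
        case False
        then have "i \<notin> Poly_Mapping.keys p'" "i \<notin> Poly_Mapping.keys p"
          using p' red unfolding reduced_def by blast+
        then show ?thesis by (simp add: in_keys_iff)
      qed
    qed
  qed (use red pf in auto)
  then show ?thesis by (simp add: keys)
qed

lemma lin_comb_in_RM_iff:
  fixes c :: "('n::finite \<Rightarrow>\<^sub>0 nat) \<Rightarrow> 'a::{field,finite}"
  shows "lin_comb c \<in> RM s \<longleftrightarrow> (\<forall>i\<in>exps CARD('a). c i \<noteq> 0 \<longrightarrow> int (total i) \<le> s)"
proof (cases "s < 0")
  case True
  \<comment> \<open>For negative \<open>s\<close> both sides say that all coefficients vanish, as
    totals are nonnegative.\<close>
  have "lin_comb c = (\<lambda>x. 0) \<longleftrightarrow> (\<forall>i\<in>exps CARD('a). c i = 0)"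
    using lin_comb_eqD[of c "\<lambda>_. 0"] by (auto simp: lin_comb_def)
  with True show ?thesis by (force simp: RM_def)
next
  case False
  \<comment> \<open>The default degree \<open>0\<close> of the zero polynomial is harmless, because
    \<open>s\<close> is nonnegative here.\<close>
  then show ?thesis
    by (auto simp: RM_def fun_degree_def total_degree_def keys_reduced_poly_lin_comb Max_insert le_nat_iff[symmetric])
qed

text \<open>Membership in the filtration becomes a system of linear equations, so closure properties
  follow from bilinearity alone. A violation in degree above \<open>s\<close> would show up at a
  coefficient of top degree.\<close>

lemma RM_iff_pairing:
  fixes f :: "'a::{field,finite}^'n::finite \<Rightarrow> 'a"
  shows "f \<in> RM s \<longleftrightarrow> (\<forall>j\<in>exps CARD('a). s < int (total j) \<longrightarrow> pairing f (dual_monom j) = 0)"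
proof -
  obtain c where f: "f = lin_comb c" by (rule lin_comb_surj)
  show ?thesis
  proof
    assume "f \<in> RM s"
    then have c: "\<forall>i\<in>exps CARD('a). c i \<noteq> 0 \<longrightarrow> int (total i) \<le> s"
      by (simp add: f lin_comb_in_RM_iff)
    show "\<forall>j\<in>exps CARD('a). s < int (total j) \<longrightarrow> pairing f (dual_monom j) = 0"
    proof (intro ballI impI)
      fix j :: "'n \<Rightarrow>\<^sub>0 nat" assume j: "j \<in> exps CARD('a)" "s < int (total j)"
      have "pairing f (dual_monom j) = c j * (-1) ^ CARD('n)"
        unfolding f using c j by (intro pairing_lin_comb) force+
      also have "c j = 0" using c j by force
      finally show "pairing f (dual_monom j) = 0" by simp
    qed
  next
    assume R: "\<forall>j\<in>exps CARD('a). s < int (total j) \<longrightarrow> pairing f (dual_monom j) = 0"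
    show "f \<in> RM s"
    proof (rule ccontr)
      assume "f \<notin> RM s"
      then obtain i where i: "i \<in> exps CARD('a)" "c i \<noteq> 0" "s < int (total i)"
        by (auto simp: f lin_comb_in_RM_iff not_le)
      obtain j where j: "j \<in> exps CARD('a)" "c j \<noteq> 0"
        "\<And>i. i \<in> exps CARD('a) \<Longrightarrow> c i \<noteq> 0 \<Longrightarrow> total i \<le> total j"
        using ex_top_coeff[of i "CARD('a)" c] i by metis
      have "pairing f (dual_monom j) = c j * (-1) ^ CARD('n)"
        unfolding f using j by (intro pairing_lin_comb) auto
      moreover have "s < int (total j)" using j(3)[OF i(1,2)] i(3) by simp
      ultimately show False using R j by auto
    qed
  qed
qed

subsection \<open>Matchings\<close>

text \<open>Think of \<open>v\<close> and \<open>w\<close> as colourings: injections preserving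
  colours permute each colour class independently. The induction chooses the image of one element
  \<open>s\<close> and removes it from \<open>T\<close>.\<close>

lemma card_inj_over:
  fixes v :: "'s \<Rightarrow> 'n::finite" and w :: "'t \<Rightarrow> 'n"
  assumes "finite S" "finite T" "\<And>k. card {t \<in> S. v t = k} = card {t \<in> T. w t = k}"
  shows "card {\<sigma> \<in> S \<rightarrow>\<^sub>E T. inj_on \<sigma> S \<and> (\<forall>t\<in>S. w (\<sigma> t) = v t)} =
    (\<Prod>k\<in>UNIV. fact (card {t \<in> S. v t = k}))"
  using assms
proof (induction S arbitrary: T rule: finite_induct)
  case empty
  then show ?case by simp
next
  case (insert s S)
  let ?B = "\<lambda>S T. {\<sigma> \<in> S \<rightarrow>\<^sub>E T. inj_on \<sigma> S \<and> (\<forall>t\<in>S. w (\<sigma> t) = v t)}"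
  let ?m = "card {t \<in> S. v t = v s}"
  let ?Ts = "{t \<in> T. w t = v s}"
  have cardS: "card {t \<in> insert s S. v t = k} = (if k = v s then Suc ?m else card {t \<in> S. v t = k})" for k
  proof -
    have "{t \<in> insert s S. v t = k} = (if k = v s then insert s {t \<in> S. v t = v s} else {t \<in> S. v t = k})"
      by auto
    then show ?thesis using insert.hyps by simp
  qed
  \<comment> \<open>Removing \<open>s\<close> and its image \<open>t\<close> lowers the count of the
    same colour on both sides, so the colour counts still agree.\<close>
  have IH: "card (?B S (T - {t})) = (\<Prod>k\<in>UNIV. fact (card {t \<in> S. v t = k}))" if t: "t \<in> ?Ts" for t
  proof (rule insert.IH)
    fix k
    have "{t' \<in> T - {t}. w t' = k} = {t \<in> T. w t = k} - (if k = v s then {t} else {})"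
      using t by auto
    then show "card {t \<in> S. v t = k} = card {t' \<in> T - {t}. w t' = k}"
      using insert.prems cardS[of k] t by (auto simp: card_Diff_singleton split: if_splits)
  qed (use insert.prems in auto)
  have fin: "finite (?B S (T - {t}))" for t
    by (rule finite_subset[of _ "S \<rightarrow>\<^sub>E (T - {t})"]) (use insert in \<open>auto intro: finite_PiE\<close>)
  \<comment> \<open>An injection is split into its value at \<open>s\<close> and the rest; the rest
    is reset to \<open>undefined\<close> at \<open>s\<close> to stay extensional.\<close>
  have "bij_betw (\<lambda>(t, \<sigma>). \<sigma>(s := t)) (SIGMA t:?Ts. ?B S (T - {t})) (?B (insert s S) T)"
  proof (rule bij_betw_byWitness[where f' = "\<lambda>\<rho>. (\<rho> s, \<rho>(s := undefined))"])
    show "\<forall>a\<in>SIGMA t:?Ts. ?B S (T - {t}).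
        ((case a of (t, \<sigma>) \<Rightarrow> \<sigma>(s := t)) s, (case a of (t, \<sigma>) \<Rightarrow> \<sigma>(s := t))(s := undefined)) = a"
      using insert.hyps by (auto simp: PiE_def extensional_def fun_eq_iff)
    show "\<forall>\<rho>\<in>?B (insert s S) T. (case (\<rho> s, \<rho>(s := undefined)) of (t, \<sigma>) \<Rightarrow> \<sigma>(s := t)) = \<rho>"
      by simp
    show "(\<lambda>(t, \<sigma>). \<sigma>(s := t)) ` (SIGMA t:?Ts. ?B S (T - {t})) \<subseteq> ?B (insert s S) T"
    proof (rule image_subsetI)
      fix a assume "a \<in> (SIGMA t:?Ts. ?B S (T - {t}))"
      then obtain t \<sigma> where a: "a = (t, \<sigma>)" and t: "t \<in> T" "w t = v s"
        and \<sigma>: "\<sigma> \<in> S \<rightarrow>\<^sub>E T - {t}" "inj_on \<sigma> S" "\<forall>t\<in>S. w (\<sigma> t) = v t"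
        by blast
      have ne: "\<sigma> t' \<noteq> t" if "t' \<in> S" for t'
        using PiE_mem[OF \<sigma>(1) that] by simp
      have "\<sigma>(s := t) \<in> insert s S \<rightarrow>\<^sub>E T"
        using \<sigma>(1) t(1) by (auto simp: PiE_def extensional_def)
      moreover have "inj_on (\<sigma>(s := t)) (insert s S)"
        using \<sigma>(2) ne insert.hyps(2) by (intro inj_onI) (auto dest: inj_onD split: if_splits)
      moreover have "\<forall>t'\<in>insert s S. w ((\<sigma>(s := t)) t') = v t'"
        using \<sigma>(3) t(2) insert.hyps(2) by auto
      ultimately show "(case a of (t, \<sigma>) \<Rightarrow> \<sigma>(s := t)) \<in> ?B (insert s S) T"
        by (simp only: a prod.case mem_Collect_eq simp_thms)
    qed
    show "(\<lambda>\<rho>. (\<rho> s, \<rho>(s := undefined))) ` ?B (insert s S) T \<subseteq> (SIGMA t:?Ts. ?B S (T - {t}))"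
    proof (rule image_subsetI)
      fix \<rho> assume "\<rho> \<in> ?B (insert s S) T"
      then have \<rho>: "\<rho> \<in> insert s S \<rightarrow>\<^sub>E T" "inj_on \<rho> (insert s S)" "\<forall>t\<in>insert s S. w (\<rho> t) = v t"
        by blast+
      have eq: "(\<rho>(s := undefined)) t = \<rho> t" if "t \<in> S" for t
        using that insert.hyps(2) by auto
      have ne: "\<rho> t \<noteq> \<rho> s" if "t \<in> S" for t
        using inj_onD[OF \<rho>(2), of t s] that insert.hyps(2) by auto
      have "\<rho>(s := undefined) \<in> S \<rightarrow>\<^sub>E T - {\<rho> s}"
      proof (rule PiE_I)
        show "(\<rho>(s := undefined)) t \<in> T - {\<rho> s}" if "t \<in> S" for t
          using eq[OF that] ne[OF that] PiE_mem[OF \<rho>(1), of t] that by simp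
        show "(\<rho>(s := undefined)) t = undefined" if "t \<notin> S" for t
          using PiE_arb[OF \<rho>(1), of t] that by simp
      qed
      moreover have "inj_on (\<rho>(s := undefined)) S"
        using \<rho>(2) eq by (simp add: inj_on_def)
      moreover have "\<rho> s \<in> ?Ts"
        using \<rho>(3) PiE_mem[OF \<rho>(1), of s] by simp
      ultimately show "(\<rho> s, \<rho>(s := undefined)) \<in> (SIGMA t:?Ts. ?B S (T - {t}))"
        using \<rho>(3) eq by simp
    qed
  qed
  from bij_betw_same_card[OF this]
  have "card (?B (insert s S) T) = card (SIGMA t:?Ts. ?B S (T - {t}))" ..
  also have "\<dots> = (\<Sum>t\<in>?Ts. card (?B S (T - {t})))"
    using insert.prems fin by simp
  also have "\<dots> = card ?Ts * (\<Prod>k\<in>UNIV. fact (card {t \<in> S. v t = k}))"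
    using IH by simp
  also have "card ?Ts = Suc ?m"
    using insert.prems(2)[of "v s"] cardS[of "v s"] by simp
  \<comment> \<open>Only the colour of \<open>s\<close> gains an element; the factor
    \<open>Suc ?m\<close> completes its factorial.\<close>
  also have "(\<Prod>k\<in>UNIV. fact (card {t \<in> S. v t = k})) =
      fact ?m * (\<Prod>k\<in>UNIV - {v s}. fact (card {t \<in> S. v t = k}))"
    by (rule prod.remove) auto
  also have "Suc ?m * (fact ?m * (\<Prod>k\<in>UNIV - {v s}. fact (card {t \<in> S. v t = k}))) =
      fact (Suc ?m) * (\<Prod>k\<in>UNIV - {v s}. fact (card {t \<in> S. v t = k}))"
    by (simp only: fact_Suc mult.assoc of_nat_id)
  also have "(\<Prod>k\<in>UNIV - {v s}. fact (card {t \<in> S. v t = k}) :: nat) =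
      (\<Prod>k\<in>UNIV - {v s}. fact (card {t \<in> insert s S. v t = k}))"
    by (rule prod.cong[OF refl], subst cardS) simp
  also have "fact (Suc ?m) * \<dots> = (\<Prod>k\<in>UNIV. fact (card {t \<in> insert s S. v t = k}))"
    using prod.remove[of UNIV "v s" "\<lambda>k. fact (card {t \<in> insert s S. v t = k}) :: nat"] cardS[of "v s"]
    by (simp only: finite UNIV_I simp_thms if_True)
  finally show ?case .
qed

text \<open>The factors of \<open>X^i\<close> as distinguishable positions, the first component
  being the variable. Labelling repeated factors lets permanents be written as sums over
  bijections.\<close>

definition slots :: "('n::finite \<Rightarrow>\<^sub>0 nat) \<Rightarrow> ('n \<times> nat) set" where
  "slots i = (SIGMA k:UNIV. {..<Poly_Mapping.lookup i k})"

lemma finite_slots [simp]: "finite (slots i)"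
  by (simp add: slots_def)

lemma card_slots: "card (slots i) = total i"
  by (simp add: slots_def total_def)

lemma card_slots_fiber: "card {t \<in> slots i. fst t = k} = Poly_Mapping.lookup i k"
proof -
  have "{t \<in> slots i. fst t = k} = Pair k ` {..<Poly_Mapping.lookup i k}"
    by (auto simp: slots_def)
  then show ?thesis by (simp add: card_image inj_on_def)
qed

lemma prod_slots:
  "(\<Prod>t\<in>slots i. y (fst t)) = (\<Prod>k\<in>UNIV. y k ^ Poly_Mapping.lookup i k)"
proof -
  have "(\<Prod>t\<in>slots i. y (fst t)) = (\<Prod>k\<in>UNIV. \<Prod>m<Poly_Mapping.lookup i k. y k)"
    unfolding slots_def by (subst prod.Sigma) (auto simp: case_prod_beta)
  then show ?thesis by simp
qed

text \<open>The exponent of the monomial obtained by multiplying the variables \<open>v t\<close>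
  over all positions \<open>t\<close>.\<close>

definition word_exp :: "'s set \<Rightarrow> ('s \<Rightarrow> 'n::finite) \<Rightarrow> ('n \<Rightarrow>\<^sub>0 nat)" where
  "word_exp S v = Abs_poly_mapping (\<lambda>k. card {t \<in> S. v t = k})"

lemma lookup_word_exp [simp]: "Poly_Mapping.lookup (word_exp S v) k = card {t \<in> S. v t = k}"
  by (simp add: word_exp_def)

lemma total_word_exp: "finite S \<Longrightarrow> total (word_exp S v) = card S"
  using sum.group[of S UNIV v "\<lambda>_. 1::nat"] by (simp add: total_def)

lemma monom_fun_word_exp:
  "finite S \<Longrightarrow> monom_fun (word_exp S v) x = (\<Prod>t\<in>S. x $ v t)"
  using prod.group[of S UNIV v "\<lambda>t. x $ v t"] by (simp add: monom_fun_def)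

text \<open>Each slot contributes a linear form; a word \<open>v\<close> selects one summand from
  each. The exponents of the words need not be reduced, but all have the total of
  \<open>i\<close>.\<close>

lemma act_monom_fun:
  fixes A :: "'a::{field,finite}^'n::finite^'n"
  shows "act A (monom_fun i) = (\<lambda>x. \<Sum>v\<in>slots i \<rightarrow>\<^sub>E UNIV.
    (\<Prod>t\<in>slots i. A $ v t $ fst t) * monom_fun (word_exp (slots i) v) x)"
proof
  fix x
  have "act A (monom_fun i) x = (\<Prod>t\<in>slots i. \<Sum>l\<in>UNIV. x $ l * A $ l $ fst t)"
    by (simp add: act_def monom_fun_def vector_matrix_mult_def prod_slots[of "\<lambda>k. \<Sum>l\<in>UNIV. x $ l * A $ l $ k"])
  also have "\<dots> = (\<Sum>v\<in>slots i \<rightarrow>\<^sub>E UNIV. \<Prod>t\<in>slots i. x $ v t * A $ v t $ fst t)"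
    by (rule prod_sum_PiE) auto
  finally show "act A (monom_fun i) x = (\<Sum>v\<in>slots i \<rightarrow>\<^sub>E UNIV.
    (\<Prod>t\<in>slots i. A $ v t $ fst t) * monom_fun (word_exp (slots i) v) x)"
    by (simp add: prod.distrib monom_fun_word_exp mult.commute)
qed

definition matchings :: "('n::finite \<Rightarrow>\<^sub>0 nat) \<Rightarrow> ('n \<Rightarrow>\<^sub>0 nat) \<Rightarrow> ('n \<times> nat \<Rightarrow> 'n \<times> nat) set" where
  "matchings i j = {\<sigma> \<in> slots i \<rightarrow>\<^sub>E slots j. bij_betw \<sigma> (slots i) (slots j)}"

lemma finite_matchings [simp]: "finite (matchings i j)"
  by (rule finite_subset[of _ "slots i \<rightarrow>\<^sub>E slots j"]) (auto simp: matchings_def intro: finite_PiE)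

text \<open>The slot sets have equal size, so injections between them are bijections. This gives the
  form that \<open>card_inj_over\<close> counts.\<close>

lemma matchings_eq_inj:
  assumes "total i = total j"
  shows "matchings i j = {\<sigma> \<in> slots i \<rightarrow>\<^sub>E slots j. inj_on \<sigma> (slots i)}"
proof -
  have "bij_betw \<sigma> (slots i) (slots j)" if "\<sigma> \<in> slots i \<rightarrow>\<^sub>E slots j" "inj_on \<sigma> (slots i)" for \<sigma>
    unfolding bij_betw_def
  proof (intro conjI card_subset_eq)
    show "card (\<sigma> ` slots i) = card (slots j)"
      using that assms by (simp add: card_image card_slots)
  qed (use that in auto)
  then show ?thesis by (auto simp: matchings_def bij_betw_def)
qed

text \<open>
  Up to sign, the right-hand side is the permanent of the matrix with rows and columns of \<open>A\<close>
  repeated as prescribed by \<open>j\<close> and \<open>i\<close>; this makes the symmetry under transposition visible.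
\<close>

lemma pairing_act_monom:
  fixes A :: "'a::{field,finite}^'n::finite^'n"
  assumes j: "j \<in> exps CARD('a)" and tot: "total i = total j"
  shows "of_nat (exp_fact j) * pairing (act A (monom_fun i)) (dual_monom j) =
    (-1) ^ CARD('n) * (\<Sum>\<sigma>\<in>matchings i j. \<Prod>t\<in>slots i. A $ fst (\<sigma> t) $ fst t)"
proof -
  let ?W = "slots i \<rightarrow>\<^sub>E (UNIV :: 'n set)"
  let ?V = "{v \<in> ?W. word_exp (slots i) v = j}"
  let ?F = "\<lambda>v. \<Prod>t\<in>slots i. A $ v t $ fst t"
  let ?g = "\<lambda>\<sigma>. restrict (fst \<circ> \<sigma>) (slots i)"
  have finW: "finite ?W" by (auto intro: finite_PiE)
  \<comment> \<open>Forgetting slot numbers turns a matching into a word that uses each variable as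
    often as \<open>j\<close> prescribes.\<close>
  have word: "word_exp (slots i) (?g \<sigma>) = j" if "\<sigma> \<in> matchings i j" for \<sigma>
  proof (rule poly_mapping_eqI)
    fix k
    have bij: "bij_betw \<sigma> (slots i) (slots j)" using that by (simp add: matchings_def)
    have "bij_betw \<sigma> {t \<in> slots i. fst (\<sigma> t) = k} {t \<in> slots j. fst t = k}"
    proof (rule bij_betw_imageI)
      show "inj_on \<sigma> {t \<in> slots i. fst (\<sigma> t) = k}"
        using bij by (rule inj_on_subset[OF bij_betw_imp_inj_on]) blast
      show "\<sigma> ` {t \<in> slots i. fst (\<sigma> t) = k} = {t \<in> slots j. fst t = k}"
        unfolding bij_betw_imp_surj_on[OF bij, symmetric] by blast
    qed
    moreover have "{t \<in> slots i. ?g \<sigma> t = k} = {t \<in> slots i. fst (\<sigma> t) = k}" by auto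
    ultimately show "Poly_Mapping.lookup (word_exp (slots i) (?g \<sigma>)) k = Poly_Mapping.lookup j k"
      by (simp only: lookup_word_exp) (simp add: bij_betw_same_card card_slots_fiber)
  qed
  \<comment> \<open>Conversely, each word with exponent \<open>j\<close> arises from exactly
    \<open>exp_fact j\<close> matchings, which accounts for the factorial.\<close>
  have fiber: "of_nat (exp_fact j) * ?F v = (\<Sum>\<sigma>\<in>{\<sigma> \<in> matchings i j. ?g \<sigma> = v}. ?F (?g \<sigma>))" if v: "v \<in> ?V" for v
  proof -
    have jv: "card {t \<in> slots i. v t = k} = Poly_Mapping.lookup j k" for k
      using v lookup_word_exp[of "slots i" v k] by simp
    have "{\<sigma> \<in> matchings i j. ?g \<sigma> = v} =
        {\<sigma> \<in> slots i \<rightarrow>\<^sub>E slots j. inj_on \<sigma> (slots i) \<and> (\<forall>t\<in>slots i. fst (\<sigma> t) = v t)}"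
      unfolding matchings_eq_inj[OF tot] using v
      by (auto simp: PiE_def extensional_def fun_eq_iff restrict_def)
    then have "card {\<sigma> \<in> matchings i j. ?g \<sigma> = v} = exp_fact j"
      by (simp add: card_inj_over jv card_slots_fiber exp_fact_def)
    moreover have "(\<Sum>\<sigma>\<in>{\<sigma> \<in> matchings i j. ?g \<sigma> = v}. ?F (?g \<sigma>)) = (\<Sum>\<sigma>\<in>{\<sigma> \<in> matchings i j. ?g \<sigma> = v}. ?F v)"
      by (rule sum.cong) auto
    ultimately show ?thesis by simp
  qed
  have "pairing (act A (monom_fun i)) (dual_monom j) =
      (\<Sum>v\<in>?W. ?F v * pairing (monom_fun (word_exp (slots i) v)) (dual_monom j))"
    by (simp add: act_monom_fun pairing_sum_left)
  \<comment> \<open>All words have total \<open>total j\<close>, so \<open>pairing_monom\<close>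
    applies even to unreduced word exponents.\<close>
  also have "\<dots> = (\<Sum>v\<in>?W. if word_exp (slots i) v = j then ?F v * (-1) ^ CARD('n) else 0)"
    using tot by (intro sum.cong refl) (simp add: pairing_monom[OF j] total_word_exp card_slots)
  also have "\<dots> = (\<Sum>v\<in>?V. ?F v * (-1) ^ CARD('n))"
    using finW by (simp add: sum.If_cases Int_def)
  finally have "of_nat (exp_fact j) * pairing (act A (monom_fun i)) (dual_monom j) =
      (-1) ^ CARD('n) * (\<Sum>v\<in>?V. of_nat (exp_fact j) * ?F v)"
    by (simp add: sum_distrib_left mult_ac)
  also have "(\<Sum>v\<in>?V. of_nat (exp_fact j) * ?F v) = (\<Sum>v\<in>?V. \<Sum>\<sigma>\<in>{\<sigma> \<in> matchings i j. ?g \<sigma> = v}. ?F (?g \<sigma>))"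
    by (intro sum.cong refl fiber)
  also have "\<dots> = (\<Sum>\<sigma>\<in>matchings i j. ?F (?g \<sigma>))"
    using finW word by (intro sum.group) (auto intro: finite_subset)
  also have "\<dots> = (\<Sum>\<sigma>\<in>matchings i j. \<Prod>t\<in>slots i. A $ fst (\<sigma> t) $ fst t)"
    by simp
  finally show ?thesis .
qed

text \<open>Passing to inverse bijections exchanges rows and columns of the permanent.\<close>

lemma sum_matchings_swap:
  fixes F :: "'n::finite \<Rightarrow> 'n \<Rightarrow> 'a::comm_semiring_1"
  shows "(\<Sum>\<sigma>\<in>matchings i j. \<Prod>t\<in>slots i. F (fst (\<sigma> t)) (fst t)) =
    (\<Sum>\<tau>\<in>matchings j i. \<Prod>s\<in>slots j. F (fst s) (fst (\<tau> s)))"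
proof -
  \<comment> \<open>Restriction keeps the inverse extensional, so that inverting twice returns
    exactly the original matching.\<close>
  let ?inv = "\<lambda>i j \<sigma>. restrict (inv_into (slots i) \<sigma>) (slots j)"
  have inv: "?inv i j \<sigma> \<in> matchings j i" "?inv j i (?inv i j \<sigma>) = \<sigma>"
    if "\<sigma> \<in> matchings i j" for i j :: "'n \<Rightarrow>\<^sub>0 nat" and \<sigma>
  proof -
    have bij: "bij_betw \<sigma> (slots i) (slots j)" and ext: "\<sigma> \<in> slots i \<rightarrow>\<^sub>E slots j"
      using that by (auto simp: matchings_def)
    have "bij_betw (?inv i j \<sigma>) (slots j) (slots i)"
      using bij_betw_inv_into[OF bij] by (simp cong: bij_betw_cong)
    then show m: "?inv i j \<sigma> \<in> matchings j i"
      by (auto simp: matchings_def bij_betw_def)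
    show "?inv j i (?inv i j \<sigma>) = \<sigma>"
    proof
      fix t
      show "?inv j i (?inv i j \<sigma>) t = \<sigma> t"
      proof (cases "t \<in> slots i")
        case True
        then have "\<sigma> t \<in> slots j" using ext by auto
        moreover have "?inv i j \<sigma> (\<sigma> t) = t"
          using True \<open>\<sigma> t \<in> slots j\<close> bij by (simp add: bij_betw_def)
        moreover have "inj_on (?inv i j \<sigma>) (slots j)"
          using m by (auto simp: matchings_def bij_betw_def)
        ultimately show ?thesis
          using True inv_into_f_f[of "?inv i j \<sigma>" "slots j" "\<sigma> t"] by simp
      next
        case False
        then show ?thesis using PiE_arb[OF ext] by simp
      qed
    qed
  qed
  show ?thesis
  proof (rule sum.reindex_bij_witness[of _ "?inv j i" "?inv i j"])
    fix \<sigma> assume \<sigma>: "\<sigma> \<in> matchings i j"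
    then have bij: "bij_betw \<sigma> (slots i) (slots j)" by (simp add: matchings_def)
    show "(\<Prod>s\<in>slots j. F (fst s) (fst (?inv i j \<sigma> s))) = (\<Prod>t\<in>slots i. F (fst (\<sigma> t)) (fst t))"
      using bij_betw_apply[OF bij] bij_betw_imp_inj_on[OF bij]
      by (subst prod.reindex_bij_betw[OF bij, symmetric]) (intro prod.cong refl, simp)
  qed (use inv in auto)
qed

text \<open>This is the apolar identity \<open>(A X^i, X^j) = (X^i, A^T X^j)\<close> up to a common
  sign. Both factorials are kept as multipliers, so that nothing is divided by zero in small
  characteristic.\<close>

lemma pairing_act_transpose:
  fixes A :: "'a::{field,finite}^'n::finite^'n"
  assumes "i \<in> exps CARD('a)" "j \<in> exps CARD('a)" "total i = total j"
  shows "of_nat (exp_fact j) * pairing (act A (monom_fun i)) (dual_monom j) =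
    of_nat (exp_fact i) * pairing (act (transpose A) (monom_fun j)) (dual_monom i)"
proof -
  have "(\<Sum>\<tau>\<in>matchings j i. \<Prod>t\<in>slots j. transpose A $ fst (\<tau> t) $ fst t) =
      (\<Sum>\<tau>\<in>matchings j i. \<Prod>t\<in>slots j. A $ fst t $ fst (\<tau> t))"
    by (simp add: transpose_def)
  then show ?thesis
    using assms sum_matchings_swap[of "\<lambda>k l. A $ k $ l" i j] by (simp add: pairing_act_monom)
qed

subsection \<open>The filtration by degree\<close>

lemma exp_compl_in_exps [simp]: "exp_compl q j \<in> exps q"
  by (simp add: exps_def del: One_nat_def diff_diff_left)

lemma exp_compl_exp_compl: "j \<in> exps q \<Longrightarrow> exp_compl q (exp_compl q j) = j"
  by (rule poly_mapping_eqI) (simp add: exps_def del: One_nat_def diff_diff_left)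

lemma total_exp_compl:
  fixes j :: "'n::finite \<Rightarrow>\<^sub>0 nat"
  assumes "j \<in> exps q"
  shows "total (exp_compl q j) + total j = CARD('n) * (q - 1)"
proof -
  have "total (exp_compl q j) + total j =
      (\<Sum>k\<in>UNIV. (q - 1 - Poly_Mapping.lookup j k) + Poly_Mapping.lookup j k)"
    by (simp add: total_def sum.distrib)
  also have "\<dots> = (\<Sum>k\<in>(UNIV :: 'n set). q - 1)"
    using assms by (intro sum.cong refl) (simp add: exps_def del: One_nat_def diff_diff_left)
  finally show ?thesis by simp
qed

lemma exp_compl_of_total:
  fixes j :: "'n::finite \<Rightarrow>\<^sub>0 nat"
  assumes "r + r' = CARD('n) * (q - 1)" "j \<in> exps_of_total q r"
  shows "exp_compl q j \<in> exps_of_total q r'"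
  using assms total_exp_compl[of j q] by (simp add: exps_of_total_def)

lemma finite_exps_of_total [simp]: "finite (exps_of_total q r :: ('n::finite \<Rightarrow>\<^sub>0 nat) set)"
  by (simp add: exps_of_total_def)

section \<open>Linear structure of the degree filtration\<close>

lemma RM_add: "f \<in> RM s \<Longrightarrow> g \<in> RM s \<Longrightarrow> (\<lambda>x. f x + g x) \<in> RM s"
  by (simp add: RM_iff_pairing pairing_add_left)

lemma RM_diff: "f \<in> RM s \<Longrightarrow> g \<in> RM s \<Longrightarrow> (\<lambda>x. f x - g x) \<in> RM s"
  by (simp add: RM_iff_pairing pairing_diff_left)

lemma RM_scale: "f \<in> RM s \<Longrightarrow> (\<lambda>x. c * f x) \<in> RM s"
  by (simp add: RM_iff_pairing pairing_scale_left)

lemma RM_zero: "(\<lambda>x. 0) \<in> RM s"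
  by (simp add: RM_iff_pairing pairing_def)

lemma RM_sum:
  "(\<And>i. i \<in> I \<Longrightarrow> f i \<in> RM s) \<Longrightarrow> (\<lambda>x. \<Sum>i\<in>I. c i * f i x) \<in> RM s"
  by (simp add: RM_iff_pairing pairing_sum_left)

lemma RM_mono: "f \<in> RM s \<Longrightarrow> s \<le> t \<Longrightarrow> f \<in> RM t"
  by (simp add: RM_iff_pairing)

lemma monom_fun_in_RM: "int (total i) \<le> s \<Longrightarrow> monom_fun i \<in> RM s"
  by (auto simp: RM_iff_pairing pairing_monom)

text \<open>The equations for totals above \<open>r\<close> hold already, so those of total exactly
  \<open>r\<close> remain. The pairings in them are, up to sign, the coordinates of the class of
  \<open>f\<close> in the quotient.\<close>

lemma RM_pred_iff:
  fixes f :: "'a::{field,finite}^'n::finite \<Rightarrow> 'a"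
  assumes "f \<in> RM (int r)"
  shows "f \<in> RM (int r - 1) \<longleftrightarrow> (\<forall>j\<in>exps_of_total CARD('a) r. pairing f (dual_monom j) = 0)"
proof
  assume "f \<in> RM (int r - 1)"
  then show "\<forall>j\<in>exps_of_total CARD('a) r. pairing f (dual_monom j) = 0"
    by (simp add: RM_iff_pairing exps_of_total_def)
next
  assume R: "\<forall>j\<in>exps_of_total CARD('a) r. pairing f (dual_monom j) = 0"
  show "f \<in> RM (int r - 1)"
    unfolding RM_iff_pairing
  proof (intro ballI impI)
    fix j :: "'n \<Rightarrow>\<^sub>0 nat" assume j: "j \<in> exps CARD('a)" "int r - 1 < int (total j)"
    show "pairing f (dual_monom j) = 0"
    proof (cases "total j = r")
      case True then show ?thesis using R j by (simp add: exps_of_total_def)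
    next
      case False
      then have "int r < int (total j)" using j by simp
      then show ?thesis using assms j(1) unfolding RM_iff_pairing by blast
    qed
  qed
qed

lemma RM_lin_combE:
  fixes f :: "'a::{field,finite}^'n::finite \<Rightarrow> 'a"
  assumes "f \<in> RM (int r)"
  obtains c where "f = lin_comb c" "\<And>i. i \<in> exps CARD('a) \<Longrightarrow> c i \<noteq> 0 \<Longrightarrow> total i \<le> r"
proof -
  obtain c where c: "f = lin_comb c" by (rule lin_comb_surj)
  with assms have "\<And>i. i \<in> exps CARD('a) \<Longrightarrow> c i \<noteq> 0 \<Longrightarrow> total i \<le> r"
    by (simp add: lin_comb_in_RM_iff)
  with c that show ?thesis by blast
qed

text \<open>All words in the expansion have the total of \<open>i\<close>, and unreduced monomials
  also lie in the expected step of the filtration.\<close>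

lemma act_monom_fun_in_RM: "act A (monom_fun i) \<in> RM (int (total i))"
  unfolding act_monom_fun
  by (intro RM_sum monom_fun_in_RM) (simp add: total_word_exp card_slots)

lemma act_lin_comb:
  fixes A :: "'a::{field,finite}^'n::finite^'n"
  shows "act A (lin_comb c) = (\<lambda>x. \<Sum>i\<in>exps CARD('a). c i * act A (monom_fun i) x)"
  by (simp add: act_def lin_comb_def)

lemma act_in_RM:
  fixes f :: "'a::{field,finite}^'n::finite \<Rightarrow> 'a"
  assumes "f \<in> RM s"
  shows "act A f \<in> RM s"
proof -
  obtain c where f: "f = lin_comb c" by (rule lin_comb_surj)
  have "(\<lambda>x. c i * act A (monom_fun i) x) \<in> RM s" if "i \<in> exps CARD('a)" for i
  proof (cases "c i = 0")
    case True then show ?thesis by (simp add: RM_zero)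
  next
    case False
    then have "int (total i) \<le> s" using assms f that by (simp add: lin_comb_in_RM_iff)
    then show ?thesis by (intro RM_scale RM_mono[OF act_monom_fun_in_RM])
  qed
  then have "(\<lambda>x. \<Sum>i\<in>exps CARD('a). 1 * (c i * act A (monom_fun i) x)) \<in> RM s"
    by (rule RM_sum)
  then show ?thesis by (simp add: f act_lin_comb)
qed

section \<open>Matrix identities and invariance of the pairing\<close>

lemma act_act: "act A (act B f) = act (A ** B) f"
  by (simp add: act_def vector_matrix_mul_assoc)

lemma act_mat_1 [simp]: "act (mat 1) f = f"
  by (simp add: act_def)

text \<open>An invertible substitution merely permutes the points over which the pairing
  sums.\<close>

lemma pairing_act_act:
  fixes A B :: "'a::{field,finite}^'n::finite^'n"
  assumes "A ** B = mat 1" "B ** A = mat 1"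
  shows "pairing (act A f) (act A g) = pairing f g"
  unfolding pairing_def act_def
  by (rule sum.reindex_bij_witness[of _ "\<lambda>x. x v* B" "\<lambda>x. x v* A"])
    (simp_all add: vector_matrix_mul_assoc assms)

lemma matrix_inv_invertible:
  assumes "invertible A"
  shows "A ** matrix_inv A = mat 1" "matrix_inv A ** A = mat 1"
  using someI_ex[OF assms[unfolded invertible_def]] by (auto simp: matrix_inv_def)

lemma transpose_matrix_inv:
  fixes A :: "'a::field^'n^'n"
  assumes "invertible A"
  shows "transpose (matrix_inv A) ** transpose A = mat 1"
    "transpose A ** transpose (matrix_inv A) = mat 1"
  using matrix_inv_invertible[OF assms]
  by (simp_all add: matrix_transpose_mul[symmetric])

subsection \<open>The map \<open>\<theta>\<close> on functions\<close>

text \<open>A lift of \<theta> to representatives: for \<open>f\<close> of degree at most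
  \<open>r\<close>, \<open>pairing f (dual_monom j)\<close> is \<open>(-1)^n\<close> times the
  coefficient of \<open>X^j\<close>. Expressing it by the pairing makes the lift linear on all
  functions.\<close>

definition theta_fun :: "nat \<Rightarrow> ('a::{field,finite}^'n::finite \<Rightarrow> 'a) \<Rightarrow> ('a^'n \<Rightarrow> 'a)" where
  "theta_fun r f = (\<lambda>x. \<Sum>j\<in>exps_of_total CARD('a) r.
     (of_nat (exp_fact j) * pairing f (dual_monom j)) * dual_monom j x)"

lemma theta_fun_add: "theta_fun r (\<lambda>x. f x + g x) = (\<lambda>x. theta_fun r f x + theta_fun r g x)"
  by (simp add: theta_fun_def pairing_add_left algebra_simps sum.distrib)

lemma theta_fun_diff: "theta_fun r (\<lambda>x. f x - g x) = (\<lambda>x. theta_fun r f x - theta_fun r g x)"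
  by (simp add: theta_fun_def pairing_diff_left algebra_simps sum_subtractf)

lemma theta_fun_scale: "theta_fun r (\<lambda>x. c * f x) = (\<lambda>x. c * theta_fun r f x)"
  by (simp add: theta_fun_def pairing_scale_left sum_distrib_left mult_ac)

text \<open>Functions of lower degree are killed exactly, so the lift does not depend on the
  representative.\<close>

lemma theta_fun_lower: "f \<in> RM (int r - 1) \<Longrightarrow> theta_fun r f = (\<lambda>x. 0)"
  by (simp add: theta_fun_def RM_iff_pairing exps_of_total_def)

lemma theta_fun_monom_fun:
  fixes i :: "'n::finite \<Rightarrow>\<^sub>0 nat"
  assumes "i \<in> exps_of_total CARD('a::{field,finite}) r"
  shows "theta_fun r (monom_fun i) =
    (\<lambda>x :: 'a^'n. (of_nat (exp_fact i) * (-1) ^ CARD('n)) * dual_monom i x)"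
proof
  fix x :: "'a^'n"
  have "theta_fun r (monom_fun i) x = (\<Sum>j\<in>exps_of_total CARD('a) r.
      if j = i then (of_nat (exp_fact i) * (-1) ^ CARD('n)) * dual_monom i x else 0)"
    unfolding theta_fun_def using assms
    by (intro sum.cong refl) (auto simp: exps_of_total_def pairing_monom)
  then show "theta_fun r (monom_fun i) x = (of_nat (exp_fact i) * (-1) ^ CARD('n)) * dual_monom i x"
    using assms by simp
qed

lemma theta_fun_in_RM:
  fixes f :: "'a::{field,finite}^'n::finite \<Rightarrow> 'a"
  assumes "r + r' = CARD('n) * (CARD('a) - 1)"
  shows "theta_fun r f \<in> RM (int r')"
  unfolding theta_fun_def
proof (intro RM_sum monom_fun_in_RM)
  fix j :: "'n \<Rightarrow>\<^sub>0 nat" assume "j \<in> exps_of_total CARD('a) r"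
  then have "exp_compl CARD('a) j \<in> exps_of_total CARD('a) r'"
    by (rule exp_compl_of_total[OF assms])
  then show "int (total (exp_compl CARD('a) j)) \<le> int r'" by (simp add: exps_of_total_def)
qed

text \<open>Duality leaves only \<open>j = i\<close>. For \<open>f\<close> of degree at most
  \<open>r\<close> the two signs cancel, and the value is \<open>i!\<close> times the coefficient of
  \<open>X^i\<close>.\<close>

lemma pairing_theta_fun:
  fixes f :: "'a::{field,finite}^'n::finite \<Rightarrow> 'a"
  assumes i: "i \<in> exps_of_total CARD('a) r"
  shows "pairing (theta_fun r f) (monom_fun i) =
    (-1) ^ CARD('n) * (of_nat (exp_fact i) * pairing f (dual_monom i))"
proof -
  have "pairing (dual_monom j) (monom_fun i :: 'a^'n \<Rightarrow> 'a) = (if j = i then (-1) ^ CARD('n) else 0)"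
    if j: "j \<in> exps_of_total CARD('a) r" for j :: "'n \<Rightarrow>\<^sub>0 nat"
    using i j by (subst pairing_commute) (auto simp: exps_of_total_def pairing_monom)
  then have "pairing (theta_fun r f) (monom_fun i) = (\<Sum>j\<in>exps_of_total CARD('a) r.
      if j = i then (-1) ^ CARD('n) * (of_nat (exp_fact i) * pairing f (dual_monom i)) else 0)"
    unfolding theta_fun_def pairing_sum_left by (intro sum.cong refl) auto
  then show ?thesis using i by simp
qed

text \<open>Complementation exchanges the exponents of totals \<open>r\<close> and
  \<open>r'\<close>, so the dual monomials in \<open>RM_pred_iff\<close> become plain monomials.
  This is the perfectness of the pairing between the two quotients.\<close>

lemma RM_compl_pred_iff:
  fixes f :: "'a::{field,finite}^'n::finite \<Rightarrow> 'a"
  assumes rr': "r + r' = CARD('n) * (CARD('a) - 1)" and f: "f \<in> RM (int r')"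
  shows "f \<in> RM (int r' - 1) \<longleftrightarrow> (\<forall>i\<in>exps_of_total CARD('a) r. pairing f (monom_fun i) = 0)"
proof -
  have "bij_betw (exp_compl CARD('a)) (exps_of_total CARD('a) r)
      (exps_of_total CARD('a) r' :: ('n \<Rightarrow>\<^sub>0 nat) set)"
    using exp_compl_of_total[OF rr'] exp_compl_of_total[of r' r] rr'
    by (intro bij_betw_byWitness[where f' = "exp_compl CARD('a)"])
      (auto simp: exps_of_total_def exp_compl_exp_compl add.commute)
  then have "(exps_of_total CARD('a) r' :: ('n \<Rightarrow>\<^sub>0 nat) set) = exp_compl CARD('a) ` exps_of_total CARD('a) r"
    by (simp add: bij_betw_def)
  then show ?thesis
    unfolding RM_pred_iff[OF f] by (simp add: exps_of_total_def exp_compl_exp_compl)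
qed

text \<open>The adjointness of \<open>A\<close> and its transpose, extended linearly from monomials
  to \<open>f\<close> and expressed through \<theta>.\<close>

lemma exp_fact_pairing_act:
  fixes A :: "'a::{field,finite}^'n::finite^'n"
  assumes f: "f \<in> RM (int r)" and i: "i \<in> exps_of_total CARD('a) r"
  shows "of_nat (exp_fact i) * pairing (act A f) (dual_monom i) =
    (-1) ^ CARD('n) * pairing (theta_fun r f) (act (transpose A) (monom_fun i))"
proof -
  have mono: "of_nat (exp_fact i) * pairing (act A (monom_fun m)) (dual_monom i) =
      (-1) ^ CARD('n) * pairing (theta_fun r (monom_fun m)) (act (transpose A) (monom_fun i))"
    if m: "m \<in> exps CARD('a)" "total m \<le> r" for m
  proof (cases "total m = r")
    case True
    then have mr: "m \<in> exps_of_total CARD('a) r" using m by (simp add: exps_of_total_def)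
    have "(-1) ^ CARD('n) * pairing (theta_fun r (monom_fun m)) (act (transpose A) (monom_fun i)) =
        of_nat (exp_fact m) * pairing (act (transpose A) (monom_fun i)) (dual_monom m)"
      unfolding theta_fun_monom_fun[OF mr] pairing_scale_left by (simp add: pairing_commute)
    then show ?thesis
      using pairing_act_transpose[of m i A] m True i by (simp add: exps_of_total_def)
  next
    case False
    \<comment> \<open>Below degree \<open>r\<close> both sides vanish: \<theta> kills the monomial,
      and its transform stays below the degree that \<open>dual_monom i\<close> detects.\<close>
    with m have "monom_fun m \<in> (RM (int r - 1) :: ('a^'n \<Rightarrow> 'a) set)"
      by (intro monom_fun_in_RM) simp
    then have "theta_fun r (monom_fun m) = (\<lambda>x :: 'a^'n. 0)"
      and "act A (monom_fun m) \<in> RM (int r - 1)"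
      by (auto intro: theta_fun_lower act_in_RM)
    then show ?thesis
      using i by (simp add: pairing_def[of "\<lambda>x. 0"] RM_iff_pairing exps_of_total_def)
  qed
  obtain c where c: "f = lin_comb c" "\<And>i. i \<in> exps CARD('a) \<Longrightarrow> c i \<noteq> 0 \<Longrightarrow> total i \<le> r"
    using RM_lin_combE[OF f] by blast
  have theta: "theta_fun r f = (\<lambda>x. \<Sum>m\<in>exps CARD('a). c m * theta_fun r (monom_fun m) x)"
    unfolding c(1) theta_fun_def lin_comb_def pairing_sum_left
    by (simp add: sum_distrib_left sum_distrib_right mult_ac sum.swap[of _ "exps CARD('a)"])
  have "of_nat (exp_fact i) * pairing (act A f) (dual_monom i) =
      (\<Sum>m\<in>exps CARD('a). c m * (of_nat (exp_fact i) * pairing (act A (monom_fun m)) (dual_monom i)))"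
    unfolding c(1) act_lin_comb pairing_sum_left by (simp add: sum_distrib_left mult_ac)
  also have "\<dots> = (\<Sum>m\<in>exps CARD('a). c m * ((-1) ^ CARD('n) *
      pairing (theta_fun r (monom_fun m)) (act (transpose A) (monom_fun i))))"
    using mono c(2) by (intro sum.cong refl) (metis mult_zero_left)
  also have "\<dots> = (-1) ^ CARD('n) * pairing (theta_fun r f) (act (transpose A) (monom_fun i))"
    unfolding theta pairing_sum_left by (simp add: sum_distrib_left mult_ac)
  finally show ?thesis .
qed

text \<open>By perfectness it suffices to test the difference against each \<open>X^i\<close> of
  total \<open>r\<close>, where invariance of the pairing and adjointness give the same
  value.\<close>

lemma theta_fun_act:
  fixes A :: "'a::{field,finite}^'n::finite^'n"
  assumes rr': "r + r' = CARD('n) * (CARD('a) - 1)" and A: "invertible A" and f: "f \<in> RM (int r)"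
  shows "(\<lambda>x. theta_fun r (act A f) x - act (transpose (matrix_inv A)) (theta_fun r f) x) \<in> RM (int r' - 1)"
proof -
  let ?B = "transpose (matrix_inv A)"
  let ?d = "\<lambda>x. theta_fun r (act A f) x - act ?B (theta_fun r f) x"
  have "?d \<in> RM (int r')"
    using theta_fun_in_RM[OF rr'] by (intro RM_diff act_in_RM)
  moreover have "pairing ?d (monom_fun i) = 0" if i: "i \<in> exps_of_total CARD('a) r" for i
  proof -
    \<comment> \<open>The matrix \<open>?B\<close> is inverse to the transpose of \<open>A\<close>,
      so \<open>X^i\<close> can be written as a transform under \<open>?B\<close> and
      \<open>?B\<close> removed from both arguments.\<close>
    have "pairing (act ?B (theta_fun r f)) (monom_fun i) =
        pairing (act ?B (theta_fun r f)) (act ?B (act (transpose A) (monom_fun i)))"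
      by (simp add: act_act transpose_matrix_inv[OF A])
    also have "\<dots> = pairing (theta_fun r f) (act (transpose A) (monom_fun i))"
      by (rule pairing_act_act[OF transpose_matrix_inv[OF A]])
    \<comment> \<open>The squared sign is inserted to match the two previous formulas.\<close>
    also have "\<dots> = (-1) ^ CARD('n) * ((-1) ^ CARD('n) *
        pairing (theta_fun r f) (act (transpose A) (monom_fun i)))"
      by (simp add: mult.assoc[symmetric] power_mult_distrib[symmetric])
    also have "\<dots> = pairing (theta_fun r (act A f)) (monom_fun i)"
      by (simp only: exp_fact_pairing_act[OF f i] pairing_theta_fun[OF i])
    finally show ?thesis by (simp add: pairing_diff_left)
  qed
  ultimately show ?thesis using RM_compl_pred_iff[OF rr'] by blast
qed

text \<open>The hypothesis gives \<open>i! f_i = 0\<close> for every top coefficient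
  \<open>f_i\<close>, and nonzero factorials can be cancelled.\<close>

lemma theta_fun_lowerD:
  fixes f :: "'a::{field,finite}^'n::finite \<Rightarrow> 'a"
  assumes rr': "r + r' = CARD('n) * (CARD('a) - 1)" and f: "f \<in> RM (int r)"
    and lower: "theta_fun r f \<in> RM (int r' - 1)"
    and nz: "\<And>i :: 'n \<Rightarrow>\<^sub>0 nat. i \<in> exps_of_total CARD('a) r \<Longrightarrow> of_nat (exp_fact i) \<noteq> (0 :: 'a)"
  shows "f \<in> RM (int r - 1)"
  unfolding RM_pred_iff[OF f]
proof
  fix i :: "'n \<Rightarrow>\<^sub>0 nat" assume i: "i \<in> exps_of_total CARD('a) r"
  then have "pairing (theta_fun r f) (monom_fun i) = 0"
    using lower RM_compl_pred_iff[OF rr' theta_fun_in_RM[OF rr']] by blast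
  then show "pairing f (dual_monom i) = 0"
    using nz[OF i] by (simp add: pairing_theta_fun[OF i])
qed

text \<open>A prime characteristic \<open>p\<close> divides \<open>k!\<close> only when
  \<open>p \<le> k\<close>. Entries stay below \<open>p\<close>: if \<open>q\<close> is prime then
  \<open>p = q\<close>, and otherwise they are at most \<open>r\<close>.\<close>

lemma of_nat_exp_fact_neq_0:
  fixes i :: "'n::finite \<Rightarrow>\<^sub>0 nat"
  assumes char: "prime CARD('a::{field,finite}) \<or> r < CHAR('a)" and i: "i \<in> exps_of_total CARD('a) r"
  shows "of_nat (exp_fact i) \<noteq> (0 :: 'a)"
proof -
  have prime: "prime CHAR('a)"
    by (intro prime_CHAR_semidom finite_imp_CHAR_pos) simp
  have "Poly_Mapping.lookup i k < CHAR('a)" for k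
    using char
  proof
    assume "prime CARD('a)"
    moreover have "CHAR('a) dvd CARD('a)"
      using of_nat_CARD_eq_0[where 'a = 'a] by (simp only: of_nat_eq_0_iff_char_dvd)
    ultimately have "CHAR('a) = CARD('a)" using prime by (simp add: primes_dvd_imp_eq)
    moreover have "Poly_Mapping.lookup i k \<le> CARD('a) - 1"
      using i by (auto simp: exps_of_total_def exps_def)
    ultimately show ?thesis using CARD_field_gt_1[where 'a = 'a] by simp
  next
    assume "r < CHAR('a)"
    moreover have "Poly_Mapping.lookup i k \<le> total i"
      unfolding total_def by (rule member_le_sum) auto
    ultimately show ?thesis using i by (simp add: exps_of_total_def)
  qed
  then have "of_nat (fact (Poly_Mapping.lookup i k)) \<noteq> (0 :: 'a)" for k
    by (simp only: of_nat_eq_0_iff_char_dvd prime_dvd_fact_iff[OF prime] not_le)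
  then show ?thesis by (simp add: exp_fact_def del: of_nat_fact)
qed

subsection \<open>The quotient spaces\<close>

lemma equiv_RM_rel: "equiv (RM (int r)) (RM_rel r)"
proof (rule equivI)
  show "RM_rel r \<subseteq> RM (int r) \<times> RM (int r)" by (auto simp: RM_rel_def)
  show "refl_on (RM (int r)) (RM_rel r)"
    by (auto simp: refl_on_def RM_rel_def RM_zero)
  show "sym (RM_rel r)"
  proof (rule symI)
    fix f g assume "(f, g) \<in> RM_rel r"
    then show "(g, f) \<in> RM_rel r"
      using RM_diff[OF RM_zero, of "\<lambda>x. f x - g x" "int r - 1"] by (simp add: RM_rel_def)
  qed
  show "trans (RM_rel r)"
  proof (rule transI)
    fix f g h assume "(f, g) \<in> RM_rel r" "(g, h) \<in> RM_rel r"
    then show "(f, h) \<in> RM_rel r"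
      using RM_add[of "\<lambda>x. f x - g x" "int r - 1" "\<lambda>x. g x - h x"] by (simp add: RM_rel_def)
  qed
qed

lemma H_class_in_H: "f \<in> RM (int r) \<Longrightarrow> H_class r f \<in> H r"
  by (simp add: H_class_def H_def quotientI)

lemma H_cases:
  assumes "U \<in> H r"
  obtains f where "f \<in> RM (int r)" "U = H_class r f"
  using assms unfolding H_def H_class_def by (auto elim: quotientE)

lemma H_class_eq_iff:
  "f \<in> RM (int r) \<Longrightarrow> g \<in> RM (int r) \<Longrightarrow>
    H_class r f = H_class r g \<longleftrightarrow> (\<lambda>x. f x - g x) \<in> RM (int r - 1)"
  unfolding H_class_def by (subst eq_equiv_class_iff[OF equiv_RM_rel]) (auto simp: RM_rel_def)

lemma H_class_eqI:
  "f \<in> RM (int r) \<Longrightarrow> g \<in> RM (int r) \<Longrightarrow> (\<lambda>x. f x - g x) \<in> RM (int r - 1) \<Longrightarrow>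
    H_class r f = H_class r g"
  by (simp add: H_class_eq_iff)

text \<open>The operations on classes are unions over all representatives; such a union collapses
  once its value is shown to be independent of the representative.\<close>

lemma UN_H_class:
  assumes f: "f \<in> RM (int r)"
    and "\<And>g. g \<in> RM (int r) \<Longrightarrow> (\<lambda>x. g x - f x) \<in> RM (int r - 1) \<Longrightarrow> \<phi> g = \<phi> f"
  shows "(\<Union>g\<in>H_class r f. \<phi> g) = \<phi> f"
proof (rule UN_constant_eq)
  show "f \<in> H_class r f"
    using f by (simp add: H_class_def RM_rel_def RM_zero)
  show "\<forall>g\<in>H_class r f. \<phi> g = \<phi> f"
  proof
    fix g assume "g \<in> H_class r f"
    then have g: "g \<in> RM (int r)" "(\<lambda>x. f x - g x) \<in> RM (int r - 1)"
      by (auto simp: H_class_def RM_rel_def)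
    then show "\<phi> g = \<phi> f"
      using RM_diff[OF RM_zero g(2)] assms(2) by simp
  qed
qed

section \<open>Evaluation of operations and linear maps on classes\<close>

lemma H_scale_class:
  assumes f: "f \<in> RM (int r)"
  shows "H_scale r c (H_class r f) = H_class r (\<lambda>x. c * f x)"
  unfolding H_scale_def
proof (rule UN_H_class[OF f])
  fix g assume g: "g \<in> RM (int r)" "(\<lambda>x. g x - f x) \<in> RM (int r - 1)"
  show "H_class r (\<lambda>x. c * g x) = H_class r (\<lambda>x. c * f x)"
    using RM_scale[OF g(2), of c] by (intro H_class_eqI RM_scale f g) (simp add: right_diff_distrib)
qed

lemma H_act_class:
  assumes f: "f \<in> RM (int r)"
  shows "H_act r A (H_class r f) = H_class r (act A f)"
  unfolding H_act_def
proof (rule UN_H_class[OF f])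
  fix g assume g: "g \<in> RM (int r)" "(\<lambda>x. g x - f x) \<in> RM (int r - 1)"
  show "H_class r (act A g) = H_class r (act A f)"
    using act_in_RM[OF g(2), of A] by (intro H_class_eqI act_in_RM f g) (simp add: act_def)
qed

lemma H_add_class:
  assumes f: "f \<in> RM (int r)" and g: "g \<in> RM (int r)"
  shows "H_add r (H_class r f) (H_class r g) = H_class r (\<lambda>x. f x + g x)"
proof -
  \<comment> \<open>The double union is collapsed one argument at a time, the other representative
    being held fixed.\<close>
  have "(\<Union>g'\<in>H_class r g. H_class r (\<lambda>x. f' x + g' x)) = H_class r (\<lambda>x. f' x + g x)"
    if f': "f' \<in> RM (int r)" for f'
    by (rule UN_H_class[OF g], rule H_class_eqI) (auto intro: RM_add f' g)
  moreover have "f' \<in> RM (int r)" if "f' \<in> H_class r f" for f'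
    using that by (auto simp: H_class_def RM_rel_def)
  ultimately have "H_add r (H_class r f) (H_class r g) = (\<Union>f'\<in>H_class r f. H_class r (\<lambda>x. f' x + g x))"
    unfolding H_add_def by auto
  also have "\<dots> = H_class r (\<lambda>x. f x + g x)"
    by (rule UN_H_class[OF f], rule H_class_eqI) (auto intro: RM_add f g)
  finally show ?thesis .
qed

text \<open>The monomial classes of total \<open>r\<close> span the quotient. This supplies the
  uniqueness needed for the description operator in \<open>theta\<close>.\<close>

lemma H_linear_ext:
  fixes T T' :: "('a::{field,finite}^'n::finite \<Rightarrow> 'a) set \<Rightarrow> ('a^'n \<Rightarrow> 'a) set"
  assumes T: "H_linear r r' T" and T': "H_linear r r' T'"
    and eq: "\<And>i. i \<in> exps_of_total CARD('a) r \<Longrightarrow>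
      T (H_class r (monom_fun i)) = T' (H_class r (monom_fun i))"
    and U: "U \<in> H r"
  shows "T U = T' U"
proof -
  have monom: "monom_fun i \<in> (RM (int r) :: ('a^'n \<Rightarrow> 'a) set)"
    if "i \<in> exps_of_total CARD('a) r" for i :: "'n \<Rightarrow>\<^sub>0 nat"
    using that by (intro monom_fun_in_RM) (simp add: exps_of_total_def)
  \<comment> \<open>Scaling by \<open>0\<close> shows that linear maps preserve the zero class,
    which starts the induction on sums.\<close>
  have zero: "S (H_class r (\<lambda>x. 0)) = H_class r' (\<lambda>x. 0)"
    if S: "H_linear r r' S" for S :: "('a^'n \<Rightarrow> 'a) set \<Rightarrow> ('a^'n \<Rightarrow> 'a) set"
  proof -
    have H: "H_class r (\<lambda>x. 0 :: 'a) \<in> (H r :: ('a^'n \<Rightarrow> 'a) set set)"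
      by (intro H_class_in_H RM_zero)
    then have "S (H_class r (\<lambda>x. 0)) \<in> H r'"
      using S by (auto simp: H_linear_def)
    then obtain g where g: "g \<in> RM (int r')" "S (H_class r (\<lambda>x. 0)) = H_class r' g"
      by (rule H_cases)
    have "S (H_scale r 0 (H_class r (\<lambda>x. 0))) = H_scale r' 0 (S (H_class r (\<lambda>x. 0)))"
      using S H by (simp add: H_linear_def)
    then show ?thesis using g by (simp add: H_scale_class RM_zero)
  qed
  have *: "T (H_class r (\<lambda>x. \<Sum>i\<in>I. c i * monom_fun i x)) = T' (H_class r (\<lambda>x. \<Sum>i\<in>I. c i * monom_fun i x))"
    if "finite I" "I \<subseteq> exps_of_total CARD('a) r" for I c
    using that
  proof (induction I rule: finite_induct)
    case empty
    then show ?case by (simp add: zero T T')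
  next
    case (insert i I)
    let ?s = "\<lambda>x. \<Sum>i\<in>I. c i * monom_fun i x"
    have s: "?s \<in> RM (int r)" using insert.prems by (intro RM_sum monom) auto
    have i: "monom_fun i \<in> (RM (int r) :: ('a^'n \<Rightarrow> 'a) set)" using insert.prems by (intro monom) simp
    have split: "H_class r (\<lambda>x. \<Sum>i\<in>insert i I. c i * monom_fun i x) =
        H_add r (H_scale r (c i) (H_class r (monom_fun i))) (H_class r ?s)"
      using insert.hyps by (simp add: H_scale_class H_add_class i s RM_scale)
    have lin: "S (H_add r (H_scale r (c i) (H_class r (monom_fun i))) (H_class r ?s)) =
        H_add r' (H_scale r' (c i) (S (H_class r (monom_fun i)))) (S (H_class r ?s))"
      if S: "H_linear r r' S" for S
    proof -
      have "H_scale r (c i) (H_class r (monom_fun i)) \<in> H r"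
        unfolding H_scale_class[OF i] by (intro H_class_in_H RM_scale i)
      then show ?thesis
        using S H_class_in_H[OF s] H_class_in_H[OF i] by (simp add: H_linear_def)
    qed
    show ?case
      unfolding split lin[OF T] lin[OF T'] using insert eq by simp
  qed
  obtain f where f: "f \<in> RM (int r)" "U = H_class r f" using U by (rule H_cases)
  obtain c where c: "f = lin_comb c" "\<And>i. i \<in> exps CARD('a) \<Longrightarrow> c i \<noteq> 0 \<Longrightarrow> total i \<le> r"
    using RM_lin_combE[OF f(1)] by blast
  let ?t = "\<lambda>x. \<Sum>i\<in>exps_of_total CARD('a) r. c i * monom_fun i x"
  \<comment> \<open>Removing the homogeneous part of degree \<open>r\<close> leaves only smaller
    totals, so \<open>f\<close> and \<open>?t\<close> represent the same class.\<close>
  have "(\<lambda>x. f x - ?t x) = lin_comb (\<lambda>i. if total i = r then 0 else c i)"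
  proof
    fix x
    have "?t x = (\<Sum>i\<in>exps CARD('a). if total i = r then c i * monom_fun i x else 0)"
      unfolding exps_of_total_def by (rule sum.inter_filter) simp
    then show "f x - ?t x = lin_comb (\<lambda>i. if total i = r then 0 else c i) x"
      unfolding c(1) lin_comb_def by (auto simp: sum_subtractf[symmetric] intro!: sum.cong)
  qed
  moreover have "lin_comb (\<lambda>i. if total i = r then 0 else c i) \<in> RM (int r - 1)"
    unfolding lin_comb_in_RM_iff
  proof (intro ballI impI)
    fix i :: "'n \<Rightarrow>\<^sub>0 nat" assume "i \<in> exps CARD('a)" "(if total i = r then 0 else c i) \<noteq> 0"
    then show "int (total i) \<le> int r - 1" using c(2)[of i] by (auto split: if_splits)
  qed
  ultimately have "U = H_class r ?t"
    unfolding f(2) by (intro H_class_eqI f RM_sum monom) auto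
  then show ?thesis by (simp add: *)
qed

text \<open>The map induced by \<open>theta_fun\<close> has the defining properties of
  \<open>theta\<close>, and linearity with extensionality makes it the only one.\<close>

lemma theta_H_class:
  fixes f :: "'a::{field,finite}^'n::finite \<Rightarrow> 'a"
  assumes rr': "r + r' = CARD('n) * (CARD('a) - 1)" and f: "f \<in> RM (int r)"
  shows "theta r r' (H_class r f) = H_class r' (theta_fun r f)"
proof -
  define T where "T = restrict (\<lambda>U. \<Union>f\<in>U. H_class r' (theta_fun r f :: 'a^'n \<Rightarrow> 'a)) (H r)"
  note RM' = theta_fun_in_RM[OF rr']
  have T_class: "T (H_class r f) = H_class r' (theta_fun r f)" if f: "f \<in> RM (int r)" for f :: "'a^'n \<Rightarrow> 'a"
  proof -
    have "(\<Union>g\<in>H_class r f. H_class r' (theta_fun r g)) = H_class r' (theta_fun r f)"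
    proof (rule UN_H_class[OF f])
      fix g assume "(\<lambda>x. g x - f x) \<in> RM (int r - 1)"
      then have "(\<lambda>x. theta_fun r g x - theta_fun r f x) = (\<lambda>x. 0)"
        by (simp only: theta_fun_diff[symmetric] theta_fun_lower)
      then show "H_class r' (theta_fun r g) = H_class r' (theta_fun r f)"
        by (intro H_class_eqI RM') (simp only: RM_zero)
    qed
    then show ?thesis by (simp add: T_def H_class_in_H f)
  qed
  have lin: "H_linear r r' T"
    unfolding H_linear_def
  proof (intro conjI allI ballI funcsetI)
    fix U :: "('a^'n \<Rightarrow> 'a) set" assume "U \<in> H r"
    then obtain f where f: "f \<in> RM (int r)" "U = H_class r f" by (rule H_cases)
    then show "T U \<in> H r'" by (simp add: T_class H_class_in_H RM')
    show "T (H_scale r c U) = H_scale r' c (T U)" for c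
      using f by (simp add: T_class H_scale_class RM' RM_scale theta_fun_scale)
    fix V :: "('a^'n \<Rightarrow> 'a) set" assume "V \<in> H r"
    then obtain g where g: "g \<in> RM (int r)" "V = H_class r g" by (rule H_cases)
    show "T (H_add r U V) = H_add r' (T U) (T V)"
      using f g by (simp add: T_class H_add_class RM' RM_add theta_fun_add)
  qed
  have basis: "T (H_class r (monom_fun i)) =
      H_scale r' (of_nat (exp_fact i) * (-1) ^ CARD('n)) (H_class r' (dual_monom i))"
    if i: "i \<in> exps_of_total CARD('a) r" for i :: "'n \<Rightarrow>\<^sub>0 nat"
  proof -
    have "monom_fun i \<in> (RM (int r) :: ('a^'n \<Rightarrow> 'a) set)"
      using i by (intro monom_fun_in_RM) (simp add: exps_of_total_def)
    moreover have "dual_monom i \<in> (RM (int r') :: ('a^'n \<Rightarrow> 'a) set)"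
      using exp_compl_of_total[OF rr' i] by (intro monom_fun_in_RM) (simp add: exps_of_total_def)
    ultimately show ?thesis by (simp only: T_class theta_fun_monom_fun[OF i] H_scale_class)
  qed
  have "theta r r' = T"
    unfolding theta_def
  proof (rule the_equality)
    show "T \<in> extensional (H r) \<and> H_linear r r' T \<and> (\<forall>i\<in>exps_of_total CARD('a) r.
        T (H_class r (monom_fun i)) =
          H_scale r' (of_nat (exp_fact i) * (-1) ^ CARD('n)) (H_class r' (dual_monom i)))"
      using lin basis by (simp add: T_def)
  next
    fix S :: "('a^'n \<Rightarrow> 'a) set \<Rightarrow> ('a^'n \<Rightarrow> 'a) set"
    assume S: "S \<in> extensional (H r) \<and> H_linear r r' S \<and> (\<forall>i\<in>exps_of_total CARD('a) r.
        S (H_class r (monom_fun i)) =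
          H_scale r' (of_nat (exp_fact i) * (-1) ^ CARD('n)) (H_class r' (dual_monom i)))"
    show "S = T"
    proof (rule extensionalityI[of _ "H r"])
      show "S U = T U" if "U \<in> H r" for U :: "('a^'n \<Rightarrow> 'a) set"
      proof (rule H_linear_ext[OF _ lin _ that])
        show "H_linear r r' S" using S by blast
        show "S (H_class r (monom_fun i)) = T (H_class r (monom_fun i))"
          if "i \<in> exps_of_total CARD('a) r" for i
          using S that unfolding basis[OF that] by blast
      qed
    qed (use S in \<open>auto simp: T_def\<close>)
  qed
  then show ?thesis using T_class[OF f] by simp
qed

text \<open>Taking the inverse transpose is an involution of the group, so every matrix is the
  contragredient of some matrix.\<close>

lemma GL_contragredient:
  fixes A :: "'a::{field,finite}^'n::finite^'n"
  assumes "A \<in> GL"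
  shows "transpose (matrix_inv A) \<in> GL"
    "transpose (matrix_inv (transpose (matrix_inv A))) = A"
proof -
  let ?B = "transpose (matrix_inv A)"
  have A: "invertible A" using assms by (simp add: GL_def)
  then have B: "invertible ?B"
    using transpose_matrix_inv[OF A] unfolding invertible_def[of ?B] by blast
  then show "?B \<in> GL" by (simp add: GL_def)
  have "transpose (matrix_inv ?B) = transpose (matrix_inv ?B) ** (matrix_inv A ** A)"
    by (simp add: matrix_inv_invertible[OF A])
  also have "\<dots> = (transpose (matrix_inv ?B) ** transpose ?B) ** A"
    by (simp add: matrix_mul_assoc)
  also have "\<dots> = A" by (simp only: transpose_matrix_inv[OF B] matrix_mul_lid)
  finally show "transpose (matrix_inv ?B) = A" .
qed

theorem theorem2p2:
  fixes r r' :: nat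
  assumes "r + r' = CARD('n::finite) * (CARD('a::{field,finite}) - 1)"
  shows "(\<forall>A \<in> (GL :: ('a^'n^'n) set). \<forall>f \<in> H r.
            theta r r' (H_act r A f) = H_act r' (transpose (matrix_inv A)) (theta r r' f)) \<and>
         (prime CARD('a) \<or> r < CHAR('a) \<longrightarrow>
            (\<forall>f \<in> (H r :: ('a^'n \<Rightarrow> 'a) set set). \<forall>g \<in> H r.
               GL_equiv r f g \<longleftrightarrow> GL_equiv r' (theta r r' f) (theta r r' g)))"
proof (intro conjI impI ballI)
  note RM' = theta_fun_in_RM[OF assms]
  have intertwine: "theta r r' (H_act r A U) = H_act r' (transpose (matrix_inv A)) (theta r r' U)"
    if A: "A \<in> GL" and U: "U \<in> H r" for A :: "'a^'n^'n" and U
  proof -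
    obtain f where f: "f \<in> RM (int r)" "U = H_class r f" using U by (rule H_cases)
    have "H_class r' (theta_fun r (act A f)) = H_class r' (act (transpose (matrix_inv A)) (theta_fun r f))"
      using A by (intro H_class_eqI RM' act_in_RM theta_fun_act[OF assms _ f(1)]) (simp add: GL_def)
    then show ?thesis
      by (simp add: f theta_H_class[OF assms] H_act_class act_in_RM RM')
  qed
  then show "theta r r' (H_act r A U) = H_act r' (transpose (matrix_inv A)) (theta r r' U)"
    if "A \<in> GL" "U \<in> H r" for A :: "'a^'n^'n" and U
    using that .
  assume char: "prime CARD('a) \<or> r < CHAR('a)"
  fix U V :: "('a^'n \<Rightarrow> 'a) set" assume U: "U \<in> H r" and V: "V \<in> H r"
  \<comment> \<open>The assumption \<open>char\<close> makes all factorials \<open>i!\<close>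
    nonzero, hence \<theta> is injective on classes.\<close>
  have inj: "U = V" if "theta r r' U = theta r r' V" "U \<in> H r" "V \<in> H r" for U V :: "('a^'n \<Rightarrow> 'a) set"
  proof -
    obtain f where f: "f \<in> RM (int r)" "U = H_class r f" using \<open>U \<in> H r\<close> by (rule H_cases)
    obtain g where g: "g \<in> RM (int r)" "V = H_class r g" using \<open>V \<in> H r\<close> by (rule H_cases)
    have "theta_fun r (\<lambda>x. f x - g x) \<in> RM (int r' - 1)"
      using that(1) f g by (simp add: theta_H_class[OF assms] H_class_eq_iff RM' theta_fun_diff)
    then have "(\<lambda>x. f x - g x) \<in> RM (int r - 1)"
      by (rule theta_fun_lowerD[OF assms RM_diff[OF f(1) g(1)]]) (rule of_nat_exp_fact_neq_0[OF char])
    then show ?thesis unfolding f(2) g(2) by (intro H_class_eqI f g)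
  qed
  show "GL_equiv r U V \<longleftrightarrow> GL_equiv r' (theta r r' U) (theta r r' V)"
  proof
    assume "GL_equiv r U V"
    then obtain A where "A \<in> GL" "H_act r A U = V" by (auto simp: GL_equiv_def)
    then show "GL_equiv r' (theta r r' U) (theta r r' V)"
      unfolding GL_equiv_def using intertwine[OF _ U] GL_contragredient(1) by metis
  next
    assume "GL_equiv r' (theta r r' U) (theta r r' V)"
    then obtain B where B: "B \<in> GL" "H_act r' B (theta r r' U) = theta r r' V"
      by (auto simp: GL_equiv_def)
    \<comment> \<open>The contragredient of \<open>?A\<close> is \<open>B\<close>, so the images of
      \<open>H_act r ?A U\<close> and \<open>V\<close> under \<theta> agree and injectivity
      applies.\<close>
    let ?A = "transpose (matrix_inv B)"
    have "theta r r' (H_act r ?A U) = theta r r' V"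
      using intertwine[OF GL_contragredient(1)[OF B(1)] U] B(2)
      by (simp only: GL_contragredient(2)[OF B(1)])
    moreover have "H_act r ?A U \<in> H r"
      using U by (auto elim!: H_cases simp: H_act_class intro!: H_class_in_H act_in_RM)
    ultimately have "H_act r ?A U = V" using V by (rule inj)
    then show "GL_equiv r U V"
      unfolding GL_equiv_def by (rule bexI[OF _ GL_contragredient(1)[OF B(1)]])
  qed
qed

end
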